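(* Let $p>2$, $T>0$, let $U\Subset\mathbb{R}^n$ be open, and let $1\le q<p-1+\frac1{n+1}$. Then $$\mathcal{B}_{\widetilde p}\to\mathcal{B}_p\quad\text{in } L^q(0,T;W^{1,q}(U))\quad\text{as }\widetilde p\to p,$$ where $\mathcal{B}_p$ denotes the Barenblatt solution with exponent $p$ normalized to have unit mass.
   Context: For $p>2$ set $\lambda=n(p-2)+p$. The Barenblatt solution is defined for $x\in\mathbb{R}^n$, $t>0$ by $$\mathcal{B}_p(x,t)=t^{-n/\lambda}\left(C-\frac{p-2}{p}\lambda^{\frac1{1-p}}\left(\frac{|x|}{t^{1/\lambda}}\right)^{\frac p{p-1}}\right)_+^{\frac{p-1}{p-2}},$$ where the constant $C=C(n,p)>0$ is chosen so that $\int_{\mathbb{R}^n}\mathcal{B}_p(x,t)\,dx=1$ for all $t>0$. It is a solution of $\partial_t u-\operatorname{div}(|\nabla u|^{p-2}\nabla u)=0$ in $\mathbb{R}^n\times(0,\infty)$ whose initial trace is Dirac's delta at the origin. $L^q(0,T;W^{1,q}(U))$ is the parabolic Sobolev space with norm $\big(\int_0^T\int_U|u|^q+|\nabla u|^q\,dx\,dt\big)^{1/q}$. $U\Subset\mathbb{R}^n$ means that $U$ is bounded. *)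

theory Defs
  imports "HOL-Analysis.Analysis"
begin

section \<open>The Barenblatt solution\<close>

definition barenblatt_lambda :: "nat \<Rightarrow> real \<Rightarrow> real" where
  "barenblatt_lambda n p = real n * (p - 2) + p"

definition barenblatt_profile :: "real \<Rightarrow> real \<Rightarrow> 'a::euclidean_space \<Rightarrow> real \<Rightarrow> real" where
  "barenblatt_profile C p x t =
     (let l = barenblatt_lambda DIM('a) p in
      t powr (- real DIM('a) / l) *
      (max 0 (C - (p - 2) / p * l powr (1 / (1 - p)) *
                  (norm x / t powr (1 / l)) powr (p / (p - 1))))
        powr ((p - 1) / (p - 2)))"

definition barenblatt_const :: "'a::euclidean_space itself \<Rightarrow> real \<Rightarrow> real" where
  "barenblatt_const d p =
     (THE C. C > 0 \<and>
        (\<forall>t>0. has_bochner_integral lebesgue (\<lambda>x::'a. barenblatt_profile C p x t) 1))"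

definition barenblatt :: "real \<Rightarrow> 'a::euclidean_space \<Rightarrow> real \<Rightarrow> real" where
  "barenblatt p x t = barenblatt_profile (barenblatt_const TYPE('a) p) p x t"

section \<open>Weak gradients and Sobolev spaces\<close>

primrec cont_diff :: "nat \<Rightarrow> ('a::euclidean_space \<Rightarrow> real) \<Rightarrow> bool" where
  "cont_diff 0 f \<longleftrightarrow> continuous_on UNIV f"
| "cont_diff (Suc k) f \<longleftrightarrow>
     (\<forall>x. f differentiable (at x)) \<and>
     (\<forall>b\<in>Basis. cont_diff k (\<lambda>x. frechet_derivative f (at x) b))"

definition test_functions :: "'a::euclidean_space set \<Rightarrow> ('a \<Rightarrow> real) set" where
  "test_functions U =
     {\<phi>. (\<forall>k. cont_diff k \<phi>) \<and>
         compact (closure {x. \<phi> x \<noteq> 0}) \<and> closure {x. \<phi> x \<noteq> 0} \<subseteq> U}"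

definition locally_integrable_on ::
    "('a::euclidean_space \<Rightarrow> 'b::euclidean_space) \<Rightarrow> 'a set \<Rightarrow> bool" where
  "locally_integrable_on f U \<longleftrightarrow>
     (\<forall>K. compact K \<and> K \<subseteq> U \<longrightarrow> set_integrable lebesgue K f)"

definition is_weak_gradient ::
    "'a::euclidean_space set \<Rightarrow> ('a \<Rightarrow> real) \<Rightarrow> ('a \<Rightarrow> 'a) \<Rightarrow> bool" where
  "is_weak_gradient U u g \<longleftrightarrow>
     locally_integrable_on u U \<and> locally_integrable_on g U \<and>
     (\<forall>\<phi>\<in>test_functions U. \<forall>b\<in>Basis.
        (LINT x:U|lebesgue. u x * frechet_derivative \<phi> (at x) b) =
        - (LINT x:U|lebesgue. (g x \<bullet> b) * \<phi> x))"

text \<open>A weak gradient is determined only up to null sets; all integrals below are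
  independent of the representative chosen here.\<close>

definition weak_gradient ::
    "'a::euclidean_space set \<Rightarrow> ('a \<Rightarrow> real) \<Rightarrow> 'a \<Rightarrow> 'a" where
  "weak_gradient U u = (SOME g. is_weak_gradient U u g)"

definition Lq_on :: "real \<Rightarrow> 'a::euclidean_space set \<Rightarrow> ('a \<Rightarrow> 'b::euclidean_space) set" where
  "Lq_on q U =
     {f. set_borel_measurable lebesgue U f \<and>
         set_integrable lebesgue U (\<lambda>x. norm (f x) powr q)}"

definition sobolev_space :: "real \<Rightarrow> 'a::euclidean_space set \<Rightarrow> ('a \<Rightarrow> real) set" where
  "sobolev_space q U = {u \<in> Lq_on q U. \<exists>g \<in> Lq_on q U. is_weak_gradient U u g}"

text \<open>The \<open>q\<close>-th power of the norm of \<open>W\<^sup>1\<^sup>,\<^sup>q(U)\<close>.\<close>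

definition sobolev_energy :: "real \<Rightarrow> 'a::euclidean_space set \<Rightarrow> ('a \<Rightarrow> real) \<Rightarrow> real" where
  "sobolev_energy q U u =
     (LINT x:U|lebesgue. \<bar>u x\<bar> powr q + norm (weak_gradient U u x) powr q)"

text \<open>The space \<open>L\<^sup>q(0,T; W\<^sup>1\<^sup>,\<^sup>q(U))\<close>: the gradient is taken in the space variable only.
  Elements are functions rather than equivalence classes, so the norm below is a seminorm.\<close>

definition parabolic_sobolev_space ::
    "real \<Rightarrow> real \<Rightarrow> 'a::euclidean_space set \<Rightarrow> ('a \<Rightarrow> real \<Rightarrow> real) set" where
  "parabolic_sobolev_space q T U =
     {u. set_borel_measurable lebesgue (U \<times> {0<..<T}) (\<lambda>(x, t). u x t) \<and>
         (AE t in lebesgue. t \<in> {0<..<T} \<longrightarrow> (\<lambda>x. u x t) \<in> sobolev_space q U) \<and>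
         set_integrable lebesgue {0<..<T} (\<lambda>t. sobolev_energy q U (\<lambda>x. u x t))}"

definition parabolic_sobolev_norm ::
    "real \<Rightarrow> real \<Rightarrow> 'a::euclidean_space set \<Rightarrow> ('a \<Rightarrow> real \<Rightarrow> real) \<Rightarrow> real" where
  "parabolic_sobolev_norm q T U u =
     (LINT t:{0<..<T}|lebesgue. sobolev_energy q U (\<lambda>x. u x t)) powr (1 / q)"

definition parabolic_sobolev_tendsto ::
    "real \<Rightarrow> real \<Rightarrow> 'a::euclidean_space set \<Rightarrow>
     ('i \<Rightarrow> 'a \<Rightarrow> real \<Rightarrow> real) \<Rightarrow> ('a \<Rightarrow> real \<Rightarrow> real) \<Rightarrow> 'i filter \<Rightarrow> bool" where
  "parabolic_sobolev_tendsto q T U f u F \<longleftrightarrow>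
     u \<in> parabolic_sobolev_space q T U \<and>
     (\<forall>\<^sub>F i in F. f i \<in> parabolic_sobolev_space q T U) \<and>
     ((\<lambda>i. parabolic_sobolev_norm q T U (\<lambda>x t. f i x t - u x t)) \<longlongrightarrow> 0) F"

end

(* The map x |-> B_p(x,t) is C^1, so its weak gradient is the classical one; weak gradients being
   unique up to null sets (du Bois-Reymond), the parabolic Sobolev norm of B_p' - B_p is the
   integral of the classical quantities. Scaling gives C(n,p) in terms of the mass of the unit
   profile, hence C(n,p), B_p and grad B_p are continuous in p. Since B_p(.,t) lives in a ball of
   radius R t^(1/lambda), the integrals of |B_p|^q and |grad B_p|^q over U are at most
   K t^(-((n+1)q-n)/lambda), and the exponent is below 1 exactly when q < p - 1 + 1/(n+1).
   Dominated convergence, first in x and then in t, concludes. *)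

theory Submission
  imports Defs
begin

section \<open>Smooth bump functions and uniqueness of weak gradients\<close>

text \<open>\<open>weak_gradient\<close> picks an arbitrary representative, so no norm can be
  computed before uniqueness is known. Test functions are smooth, hence the bump functions: they
  turn the weak identity into vanishing integrals over boxes. B_p(.,t) is C^1 although its formula
  has two singular places. The outer exponent (p-1)/(p-2) exceeds 1, which smooths the free
  boundary, and the inner exponent p/(p-1) exceeds 1, which smooths the origin. The full range of q
  is reached only because the volume t^(n/\<lambda>) of the support enters the estimate; using the
  measure of U instead would lose n/\<lambda> in the exponent of t. The strength of the singularity
  at t = 0 depends on p', so a bound for p alone dominates nothing. Since the inequality for q is
  strict, some fixed \<theta> < 1 lies above the exponents of all p' near p, and a multiple of
  t^(-\<theta>) dominates them together. Dominated convergence is used for sequences, so the limit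
  p' -> p is taken along sequences.\<close>

lemma cont_diff_SucI:
  assumes "\<And>x. (f has_derivative f' x) (at x)"
    and "\<And>b. b \<in> Basis \<Longrightarrow> cont_diff k (\<lambda>x. f' x b)"
  shows "cont_diff (Suc k) f"
proof -
  have "frechet_derivative f (at x) = f' x" for x
    using frechet_derivative_at[OF assms(1)] by simp
  then show ?thesis
    using assms by (auto simp: differentiable_def)
qed

lemma cont_diff_SucD: "cont_diff (Suc k) f \<Longrightarrow> cont_diff k f"
proof (induction k arbitrary: f)
  case 0
  then show ?case
    by (auto intro!: differentiable_imp_continuous_on simp: differentiable_on_def)
qed auto

lemma cont_diff_const: "cont_diff k (\<lambda>x. c)"
proof (induction k arbitrary: c)
  case (Suc k)
  show ?case by (rule cont_diff_SucI[where f' = "\<lambda>_ _. 0"]) (auto intro: Suc)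
qed auto

lemma cont_diff_add:
  "cont_diff k f \<Longrightarrow> cont_diff k g \<Longrightarrow> cont_diff k (\<lambda>x. f x + g x)"
proof (induction k arbitrary: f g)
  case 0
  then show ?case by (auto intro: continuous_intros)
next
  case (Suc k)
  show ?case
    by (rule cont_diff_SucI[where f' = "\<lambda>x v. frechet_derivative f (at x) v + frechet_derivative g (at x) v"])
      (use Suc in \<open>auto intro!: has_derivative_add simp: frechet_derivative_works\<close>)
qed

lemma cont_diff_mult:
  "cont_diff k f \<Longrightarrow> cont_diff k g \<Longrightarrow> cont_diff k (\<lambda>x. f x * g x)"
proof (induction k arbitrary: f g)
  case 0
  then show ?case by (auto intro: continuous_intros)
next
  case (Suc k)
  note fg = cont_diff_SucD[OF Suc.prems(1)] cont_diff_SucD[OF Suc.prems(2)]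
  show ?case
    by (rule cont_diff_SucI[where f' = "\<lambda>x v. f x * frechet_derivative g (at x) v + frechet_derivative f (at x) v * g x"])
      (use Suc fg in \<open>auto intro!: has_derivative_mult cont_diff_add simp: frechet_derivative_works\<close>)
qed

lemma cont_diff_prod:
  "finite I \<Longrightarrow> (\<And>i. i \<in> I \<Longrightarrow> cont_diff k (f i)) \<Longrightarrow> cont_diff k (\<lambda>x. \<Prod>i\<in>I. f i x)"
  by (induction I rule: finite_induct) (auto intro: cont_diff_mult cont_diff_const)

text \<open>The functions \<open>x\<^sup>-\<^sup>j exp (-1/x)\<close> span a space closed under differentiation,
  so smoothness follows by induction for all \<open>j\<close> at once.\<close>

definition ramp :: "nat \<Rightarrow> real \<Rightarrow> real" where
  "ramp j x = (if x > 0 then inverse x ^ j * exp (- inverse x) else 0)"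

lemma ramp_tendsto_0: "(ramp j \<longlongrightarrow> 0) (at 0)"
proof -
  have "((\<lambda>y. y ^ j / exp y) \<longlongrightarrow> (0::real)) at_top"
    by (rule tendsto_power_div_exp_0)
  then have "((\<lambda>x. inverse x ^ j / exp (inverse x)) \<longlongrightarrow> (0::real)) (at_right 0)"
    by (rule filterlim_compose[OF _ filterlim_inverse_at_top_right])
  moreover have "\<forall>\<^sub>F x in at_right 0. inverse x ^ j / exp (inverse x) = ramp j x"
    unfolding eventually_at_filter by (auto simp: ramp_def exp_minus divide_inverse)
  ultimately have "(ramp j \<longlongrightarrow> 0) (at_right 0)"
    by (rule Lim_transform_eventually)
  moreover have "(ramp j \<longlongrightarrow> 0) (at_left 0)"
    by (rule Lim_transform_eventually[OF tendsto_const])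
      (auto simp: ramp_def eventually_at_filter)
  ultimately show ?thesis by (simp add: filterlim_split_at)
qed

text \<open>For x > 0 this is the product rule; each derivative of 1/x contributes two further
  factors 1/x. The only delicate point is x = 0.\<close>

lemma DERIV_ramp: "(ramp j has_real_derivative - real j * ramp (Suc j) x + ramp (Suc (Suc j)) x) (at x)"
proof (cases x "0 :: real" rule: linorder_cases)
  case less
  have ev: "\<forall>\<^sub>F y in nhds x. ramp j y = 0"
    by (rule eventually_mono[OF eventually_nhds_in_open[of "{..<0}"]]) (use less in \<open>auto simp: ramp_def\<close>)
  have "((\<lambda>_. 0) has_real_derivative - real j * ramp (Suc j) x + ramp (Suc (Suc j)) x) (at x)"
    using less by (simp add: ramp_def)
  then show ?thesis
    by (subst DERIV_cong_ev[OF refl ev refl])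
next
  case greater
  have ev: "\<forall>\<^sub>F y in nhds x. ramp j y = inverse y ^ j * exp (- inverse y)"
    by (rule eventually_mono[OF eventually_nhds_in_open[of "{0<..}"]]) (use greater in \<open>auto simp: ramp_def\<close>)
  define r where "r = inverse x"
  have "(inverse has_real_derivative - (r * r)) (at x)"
    using greater DERIV_inverse[of x] by (simp add: r_def power2_eq_square)
  from DERIV_mult[OF DERIV_power[OF this, of j] DERIV_fun_exp[OF DERIV_minus[OF this]]]
  have "((\<lambda>y. inverse y ^ j * exp (- inverse y)) has_real_derivative
      real j * (- (r * r) * r ^ (j - Suc 0)) * exp (- r) + exp (- r) * (r * r) * r ^ j) (at x)"
    by (simp add: r_def)
  moreover have "real j * (- (r * r) * r ^ (j - Suc 0)) * exp (- r) + exp (- r) * (r * r) * r ^ j =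
      - real j * ramp (Suc j) x + ramp (Suc (Suc j)) x"
    using greater by (cases j) (simp_all add: ramp_def r_def[symmetric] algebra_simps)
  ultimately have "((\<lambda>y. inverse y ^ j * exp (- inverse y)) has_real_derivative
      - real j * ramp (Suc j) x + ramp (Suc (Suc j)) x) (at x)"
    by simp
  then show ?thesis
    by (subst DERIV_cong_ev[OF refl ev refl])
next
  case equal
  \<comment> \<open>The difference quotient at 0 is again a ramp, one index higher, so the limit at
    0 of every ramp already gives the derivative.\<close>
  have "\<forall>\<^sub>F h in at 0. ramp (Suc j) h = (ramp j (0 + h) - ramp j 0) / h"
    unfolding eventually_at_filter by (auto simp: ramp_def divide_inverse)
  then have "((\<lambda>h. (ramp j (0 + h) - ramp j 0) / h) \<longlongrightarrow> 0) (at 0)"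
    by (rule Lim_transform_eventually[OF ramp_tendsto_0])
  then show ?thesis
    using equal by (simp add: DERIV_def ramp_def)
qed

text \<open>An affine argument survives differentiation: the derivative in direction w is a
  combination of ramps of the same argument times the constant \<open>w \<bullet> v\<close>. Hence
  the induction closes.\<close>

lemma cont_diff_ramp: "cont_diff k (\<lambda>x. ramp j (x \<bullet> v + c))"
proof (induction k arbitrary: j)
  case 0
  have "continuous_on UNIV (ramp j)"
    by (rule DERIV_continuous_on[OF has_field_derivative_at_within[OF DERIV_ramp]])
  then show ?case
    by (auto intro!: continuous_on_compose2[of UNIV "ramp j"] continuous_intros)
next
  case (Suc k)
  have "((\<lambda>x. ramp j (x \<bullet> v + c)) has_derivative
      (\<lambda>w. (- real j * ramp (Suc j) (x \<bullet> v + c) + ramp (Suc (Suc j)) (x \<bullet> v + c)) * (w \<bullet> v))) (at x)" for x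
    by (rule has_derivative_compose[where f = "\<lambda>x. x \<bullet> v + c" and g = "ramp j" and g' = "(*) _",
          OF _ DERIV_ramp[unfolded has_field_derivative_def]])
      (auto intro!: derivative_eq_intros)
  then show ?case
    by (rule cont_diff_SucI) (intro cont_diff_mult cont_diff_add cont_diff_const Suc)
qed

text \<open>A smooth approximation of the indicator of \<open>box a c\<close>: each factor is
  exp(-1/(m y)) with y the distance to one face, and increasing m pushes it towards 1 inside the
  box.\<close>

definition bump :: "real \<Rightarrow> 'a \<Rightarrow> 'a \<Rightarrow> 'a::euclidean_space \<Rightarrow> real" where
  "bump m a c x = (\<Prod>b\<in>Basis. ramp 0 (m * ((x - a) \<bullet> b)) * ramp 0 (m * ((c - x) \<bullet> b)))"

lemma cont_diff_bump: "cont_diff k (bump m a c)"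
proof -
  have "cont_diff k (\<lambda>x::'a. ramp 0 (m * ((x - a) \<bullet> b)))" for b
    using cont_diff_ramp[of k 0 "m *\<^sub>R b" "- m * (a \<bullet> b)"] by (simp add: algebra_simps)
  moreover have "cont_diff k (\<lambda>x::'a. ramp 0 (m * ((c - x) \<bullet> b)))" for b
    using cont_diff_ramp[of k 0 "- m *\<^sub>R b" "m * (c \<bullet> b)"] by (simp add: algebra_simps)
  ultimately show ?thesis
    unfolding bump_def by (intro cont_diff_prod cont_diff_mult) auto
qed

lemma ramp_0_bounds: "0 \<le> ramp 0 x" "ramp 0 x \<le> 1"
  by (auto simp: ramp_def)

lemma bump_bounds: "0 \<le> bump m a c x" "bump m a c x \<le> 1"
  unfolding bump_def
  by (auto intro!: prod_nonneg prod_le_1 mult_nonneg_nonneg mult_le_one ramp_0_bounds)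

lemma bump_outside:
  assumes "m \<ge> 0" "x \<notin> box a c" shows "bump m a c x = 0"
proof -
  obtain b where "b \<in> Basis" "x \<bullet> b \<le> a \<bullet> b \<or> c \<bullet> b \<le> x \<bullet> b"
    using assms(2) by (auto simp: mem_box not_less)
  then have "ramp 0 (m * ((x - a) \<bullet> b)) * ramp 0 (m * ((c - x) \<bullet> b)) = 0"
    using assms(1) by (auto simp: ramp_def inner_diff_left zero_less_mult_iff)
  then show ?thesis
    unfolding bump_def using \<open>b \<in> Basis\<close> by (intro prod_zero) auto
qed

lemma bump_tendsto_indicator: "(\<lambda>n. bump (real n) a c x) \<longlonglongrightarrow> indicator (box a c) x"
proof (cases "x \<in> box a c")
  case False
  then show ?thesis by (simp add: bump_outside)
next
  case True
  have *: "(\<lambda>n. ramp 0 (real n * y)) \<longlonglongrightarrow> 1" if "y > 0" for y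
  proof -
    have "(\<lambda>n. exp (- inverse (real n) * inverse y)) \<longlonglongrightarrow> exp (- 0 * inverse y)"
      by (intro tendsto_intros LIMSEQ_inverse_real_of_nat lim_inverse_n)
    moreover have "\<forall>\<^sub>F n in sequentially. exp (- inverse (real n) * inverse y) = ramp 0 (real n * y)"
      using eventually_gt_at_top[of 0] by eventually_elim (use that in \<open>auto simp: ramp_def\<close>)
    ultimately show ?thesis
      by (simp add: Lim_transform_eventually)
  qed
  have "(\<lambda>n. bump (real n) a c x) \<longlonglongrightarrow> (\<Prod>b\<in>(Basis::'a set). 1 * 1)"
    unfolding bump_def
    by (intro tendsto_prod tendsto_mult *) (use True in \<open>auto simp: mem_box inner_diff_left\<close>)
  then show ?thesis using True by simp
qed

lemma bump_test_function:
  assumes "m \<ge> 0" "cbox a c \<subseteq> U"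
  shows "bump m a c \<in> test_functions U"
proof -
  have "{x. bump m a c x \<noteq> 0} \<subseteq> cbox a c"
    using bump_outside[OF assms(1)] box_subset_cbox by blast
  then have *: "closure {x. bump m a c x \<noteq> 0} \<subseteq> cbox a c"
    by (rule closure_minimal) auto
  moreover have "compact (closure {x. bump m a c x \<noteq> 0})"
    using bounded_subset[OF bounded_cbox *] by (auto simp: compact_eq_bounded_closed)
  ultimately show ?thesis
    using assms(2) cont_diff_bump by (auto simp: test_functions_def)
qed

section \<open>Uniqueness of weak gradients by the du Bois-Reymond lemma\<close>

text \<open>Bumps of growing sharpness tend to the indicator of the open box and stay between 0 and
  1 inside it, so |f| on the closed box dominates and the vanishing pairings pass to the
  limit.\<close>

lemma box_integral_zero:
  fixes f :: "'a::euclidean_space \<Rightarrow> real"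
  assumes f: "locally_integrable_on f U"
    and z: "\<And>\<phi>. \<phi> \<in> test_functions U \<Longrightarrow> (LINT x:U|lebesgue. f x * \<phi> x) = 0"
    and sub: "cbox a c \<subseteq> U"
  shows "(LINT x:cbox a c|lebesgue. f x) = 0"
proof -
  have int: "set_integrable lebesgue (cbox a c) f"
    using f sub by (auto simp: locally_integrable_on_def)
  have meas: "(\<lambda>x. indicator (cbox a c) x * f x) \<in> borel_measurable lebesgue"
    using int by (auto simp: set_integrable_def)
  have cont: "continuous_on UNIV (bump m a c)" for m
    using cont_diff_bump[of 0 m a c] by simp
  have bm: "bump m a c \<in> borel_measurable lebesgue" for m
    by (intro measurable_completion) (use borel_measurable_continuous_onI[OF cont] in simp)
  have "(\<lambda>n. LINT x|lebesgue. indicator (cbox a c) x * f x * bump (real n) a c x)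
      \<longlonglongrightarrow> (LINT x|lebesgue. indicator (box a c) x * f x)"
  proof (rule integral_dominated_convergence[where w = "\<lambda>x. norm (indicator (cbox a c) x * f x)"])
    show "AE x in lebesgue. (\<lambda>n. indicator (cbox a c) x * f x * bump (real n) a c x) \<longlonglongrightarrow> indicator (box a c) x * f x"
    proof (rule AE_I2)
      fix x
      have "(\<lambda>n. indicator (cbox a c) x * f x * bump (real n) a c x) \<longlonglongrightarrow> indicator (cbox a c) x * f x * indicator (box a c) x"
        by (intro tendsto_intros bump_tendsto_indicator)
      then show "(\<lambda>n. indicator (cbox a c) x * f x * bump (real n) a c x) \<longlonglongrightarrow> indicator (box a c) x * f x"
        using box_subset_cbox[of a c] by (auto simp: indicator_def split: if_splits)
    qed
    show "AE x in lebesgue. norm (indicator (cbox a c) x * f x * bump (real n) a c x) \<le> norm (indicator (cbox a c) x * f x)" for n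
      using bump_bounds[of "real n" a c] by (auto simp: abs_mult intro!: mult_left_le)
    have "(\<lambda>x. indicator (box a c) x * (indicator (cbox a c) x * f x)) \<in> borel_measurable lebesgue"
      by (intro borel_measurable_times meas borel_measurable_indicator) auto
    moreover have "(\<lambda>x. indicator (box a c) x * (indicator (cbox a c) x * f x)) = (\<lambda>x. indicator (box a c) x * f x)"
      using box_subset_cbox[of a c] by (auto simp: indicator_def fun_eq_iff)
    ultimately show "(\<lambda>x. indicator (box a c) x * f x) \<in> borel_measurable lebesgue" by simp
  qed (use int meas bm in \<open>auto simp: set_integrable_def intro!: integrable_abs\<close>)
  moreover have "(LINT x|lebesgue. indicator (cbox a c) x * f x * bump (real n) a c x) = 0" for n
  proof -
    have "(LINT x|lebesgue. indicator (cbox a c) x * f x * bump (real n) a c x) =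
        (LINT x:U|lebesgue. f x * bump (real n) a c x)"
      unfolding set_lebesgue_integral_def
      using bump_outside[of "real n" _ a c] box_subset_cbox[of a c] sub
      by (intro Bochner_Integration.integral_cong) (auto simp: indicator_def)
    then show ?thesis
      using z[OF bump_test_function[OF _ sub]] by simp
  qed
  ultimately have 0: "(LINT x:box a c|lebesgue. f x) = 0"
    by (simp add: LIMSEQ_const_iff set_lebesgue_integral_def)
  \<comment> \<open>The limit only sees the open box; the faces are a null set.\<close>
  have "cbox a c - box a c \<in> null_sets lebesgue"
    using negligible_frontier_interval by (simp add: negligible_iff_null_sets)
  moreover have "{x. x \<in> cbox a c \<longleftrightarrow> x \<notin> box a c} = cbox a c - box a c"
    using box_subset_cbox[of a c] by blast
  ultimately have "AE x in lebesgue. x \<in> cbox a c \<longleftrightarrow> x \<in> box a c"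
    by (simp add: completion.AE_iff_null_sets)
  then have "(LINT x:cbox a c|lebesgue. f x) = (LINT x:box a c|lebesgue. f x)"
    using int set_integrable_subset[OF int, of "box a c"] box_subset_cbox[of a c]
    by (intro set_integral_cong_set) (auto simp: set_borel_measurable_def set_integrable_def)
  then show ?thesis using 0 by simp
qed

text \<open>By Lebesgue differentiation f(x) is, at almost every x, the limit of averages over the
  cubes x + [0,h]^n. Small cubes lie in U, where all these averages vanish.\<close>

lemma du_Bois_Reymond:
  fixes f :: "'a::euclidean_space \<Rightarrow> real"
  assumes f: "locally_integrable_on f U" and U: "open U"
    and z: "\<And>\<phi>. \<phi> \<in> test_functions U \<Longrightarrow> (LINT x:U|lebesgue. f x * \<phi> x) = 0"
  shows "AE x in lebesgue. x \<in> U \<longrightarrow> f x = 0"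
proof -
  let ?F = "{box a c | a c. cbox a c \<subseteq> U}"
  have ae: "AE x in lebesgue. x \<in> box a c \<longrightarrow> f x = 0" if sub: "cbox a c \<subseteq> U" for a c
  proof -
    \<comment> \<open>Cutting f off outside a closed box makes it integrable on every box, as the
      differentiation theorem requires.\<close>
    define g where "g = (\<lambda>x. indicator (cbox a c) x * f x)"
    have "integrable lebesgue g"
      using f sub by (auto simp: locally_integrable_on_def set_integrable_def g_def)
    then have "set_integrable lebesgue (cbox a' c') g" for a' c'
      by (simp only: set_integrable_def) (rule integrable_mult_indicator, auto)
    then have "g integrable_on cbox a' c'" for a' c'
      by (rule set_lebesgue_integral_eq_integral)
    then obtain N where N: "negligible N"
      "\<And>x e. x \<notin> N \<Longrightarrow> 0 < e \<Longrightarrow> \<exists>d>0. \<forall>h. 0 < h \<and> h < d \<longrightarrow>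
         norm (integral (cbox x (x + h *\<^sub>R One)) g /\<^sub>R h ^ DIM('a) - g x) < e"
      by (metis integrable_ccontinuous_explicit)
    have "f x = 0" if x: "x \<notin> N" "x \<in> box a c" for x
    proof (rule ccontr)
      assume "f x \<noteq> 0"
      \<comment> \<open>With tolerance |f x| and vanishing average the estimate will read |f x| < |f
        x|.\<close>
      then obtain d where d: "d > 0"
        "\<And>h. 0 < h \<Longrightarrow> h < d \<Longrightarrow>
         norm (integral (cbox x (x + h *\<^sub>R One)) g /\<^sub>R h ^ DIM('a) - g x) < \<bar>f x\<bar>"
        using N(2)[OF x(1), of "\<bar>f x\<bar>"] by auto
      \<comment> \<open>The cubes grow from x in the positive directions only, so just the distances
        to the upper faces matter.\<close>
      define \<delta> where "\<delta> = Min ((\<lambda>b. (c - x) \<bullet> b) ` Basis)"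
      have "\<delta> > 0"
        unfolding \<delta>_def using x(2) by (subst Min_gr_iff) (auto simp: mem_box inner_diff_left)
      define h where "h = min d \<delta> / 2"
      have h: "0 < h" "h < d" "h \<le> \<delta>"
        using \<open>d > 0\<close> \<open>\<delta> > 0\<close> by (auto simp: h_def)
      have "h \<le> (c - x) \<bullet> b" if "b \<in> Basis" for b
        using h(3) that unfolding \<delta>_def by (subst (asm) Min_ge_iff) auto
      then have sub': "cbox x (x + h *\<^sub>R One) \<subseteq> cbox a c"
        using x(2) by (fastforce simp: mem_box inner_diff_left inner_add_left)
      then have int: "set_integrable lebesgue (cbox x (x + h *\<^sub>R One)) f"
        using f sub by (auto simp: locally_integrable_on_def)
      have "integral (cbox x (x + h *\<^sub>R One)) g = integral (cbox x (x + h *\<^sub>R One)) f"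
        using sub' by (intro Henstock_Kurzweil_Integration.integral_cong) (auto simp: g_def)
      also have "\<dots> = 0"
        using box_integral_zero[OF f z order.trans[OF sub' sub]] set_lebesgue_integral_eq_integral(2)[OF int]
        by simp
      finally show False
        using d(2)[OF h(1,2)] x(2) box_subset_cbox[of a c] by (auto simp: g_def)
    qed
    moreover have "AE x in lebesgue. x \<notin> N"
      using N(1) by (simp add: negligible_iff_null_sets AE_not_in)
    ultimately show ?thesis
      by (auto elim!: eventually_mono)
  qed
  have U_eq: "\<Union>?F = U"
  proof
    show "U \<subseteq> \<Union>?F"
    proof
      fix x assume "x \<in> U"
      then obtain a c where "cbox a c \<subseteq> U" "x \<in> box a c"
        by (metis U open_contains_cbox)
      then show "x \<in> \<Union>?F" by blast
    qed
  qed (use box_subset_cbox in blast)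
  \<comment> \<open>Each box carries its own exceptional null set, so a countable subcover is
    needed.\<close>
  obtain \<F> where \<F>: "\<F> \<subseteq> ?F" "countable \<F>" "\<Union>\<F> = \<Union>?F"
    by (rule Lindelof[of ?F]) auto
  have "AE x in lebesgue. \<forall>X\<in>\<F>. x \<in> X \<longrightarrow> f x = 0"
    using \<F>(1) ae by (intro AE_ball_countable'[OF _ \<F>(2)]) blast
  then show ?thesis
    using \<F>(3) U_eq by (auto elim!: eventually_mono)
qed

lemma test_function_bounded_support:
  assumes "\<phi> \<in> test_functions U"
  obtains K M where "compact K" "K \<subseteq> U" "\<forall>x. x \<notin> K \<longrightarrow> \<phi> x = 0" "\<forall>x. \<bar>\<phi> x\<bar> \<le> M" "0 \<le> M"
    "continuous_on UNIV \<phi>"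
proof -
  define K where "K = closure {x. \<phi> x \<noteq> 0}"
  have K: "compact K" "K \<subseteq> U" and c: "continuous_on UNIV \<phi>"
    using assms by (auto simp: test_functions_def K_def dest: spec[of _ 0])
  have z: "\<forall>x. x \<notin> K \<longrightarrow> \<phi> x = 0"
    unfolding K_def using closure_subset[of "{x. \<phi> x \<noteq> 0}"] by auto
  have "bounded (\<phi> ` K)"
    using K(1) c by (meson compact_continuous_image compact_imp_bounded continuous_on_subset subset_UNIV)
  then obtain M where M: "\<forall>x\<in>K. \<bar>\<phi> x\<bar> \<le> M"
    by (auto simp: bounded_iff)
  have bd: "\<forall>x. \<bar>\<phi> x\<bar> \<le> max 0 M"
  proof
    fix x show "\<bar>\<phi> x\<bar> \<le> max 0 M"
      using M z by (cases "x \<in> K") (auto simp: le_max_iff_disj)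
  qed
  show thesis
    by (rule that[OF K z bd _ c]) auto
qed

lemma set_integrable_mult_test_function:
  fixes f :: "'a::euclidean_space \<Rightarrow> real"
  assumes f: "locally_integrable_on f U" and \<phi>: "\<phi> \<in> test_functions U"
  shows "set_integrable lebesgue U (\<lambda>x. f x * \<phi> x)"
proof -
  obtain K M where K: "compact K" "K \<subseteq> U" "\<forall>x. x \<notin> K \<longrightarrow> \<phi> x = 0"
    and M: "\<forall>x. \<bar>\<phi> x\<bar> \<le> M" "0 \<le> M" and c: "continuous_on UNIV \<phi>"
    by (rule test_function_bounded_support[OF \<phi>])
  have int: "integrable lebesgue (\<lambda>x. indicator K x * f x)"
    using f K by (auto simp: locally_integrable_on_def set_integrable_def)
  have "\<phi> \<in> borel_measurable lebesgue"
    by (intro measurable_completion) (use borel_measurable_continuous_onI[OF c] in simp)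
  then have "(\<lambda>x. (indicator K x * f x) * \<phi> x) \<in> borel_measurable lebesgue"
    by (rule borel_measurable_times[OF borel_measurable_integrable[OF int]])
  then have "integrable lebesgue (\<lambda>x. (indicator K x * f x) * \<phi> x)"
    by (rule Bochner_Integration.integrable_bound[OF integrable_mult_left[OF integrable_abs[OF int], of M]])
      (use M in \<open>auto simp: abs_mult intro!: mult_left_mono\<close>)
  moreover have "(\<lambda>x. (indicator K x * f x) * \<phi> x) = (\<lambda>x. indicator U x *\<^sub>R (f x * \<phi> x))"
    using K by (auto simp: fun_eq_iff indicator_def)
  ultimately show ?thesis
    by (simp add: set_integrable_def)
qed

lemma locally_integrable_on_inner:
  "locally_integrable_on g U \<Longrightarrow> locally_integrable_on (\<lambda>x. g x \<bullet> b) U"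
  unfolding locally_integrable_on_def set_integrable_def
  by (auto simp flip: inner_scaleR_left)

text \<open>Both gradients pair equally with every test function in every coordinate, so du
  Bois-Reymond applies to the finitely many components of \<open>g x - h x\<close>. This makes the
  choice inside \<open>weak_gradient\<close> harmless.\<close>

lemma is_weak_gradient_unique:
  assumes U: "open U" and g: "is_weak_gradient U u g" and h: "is_weak_gradient U u h"
  shows "AE x in lebesgue. x \<in> U \<longrightarrow> g x = h x"
proof -
  have "AE x in lebesgue. x \<in> U \<longrightarrow> (g x - h x) \<bullet> b = 0" if b: "b \<in> Basis" for b
  proof (rule du_Bois_Reymond[OF _ U])
    have gb: "locally_integrable_on (\<lambda>x. g x \<bullet> b) U" and hb: "locally_integrable_on (\<lambda>x. h x \<bullet> b) U"
      using g h by (auto simp: is_weak_gradient_def intro: locally_integrable_on_inner)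
    then show "locally_integrable_on (\<lambda>x. (g x - h x) \<bullet> b) U"
      by (auto simp: locally_integrable_on_def inner_diff_left)
    fix \<phi> assume \<phi>: "\<phi> \<in> test_functions U"
    have "(LINT x:U|lebesgue. (g x \<bullet> b) * \<phi> x) = (LINT x:U|lebesgue. (h x \<bullet> b) * \<phi> x)"
      using g h \<phi> b by (simp add: is_weak_gradient_def)
    then show "(LINT x:U|lebesgue. (g x - h x) \<bullet> b * \<phi> x) = 0"
      using set_integral_diff(2)[OF set_integrable_mult_test_function[OF gb \<phi>] set_integrable_mult_test_function[OF hb \<phi>]]
      by (simp add: inner_diff_left left_diff_distrib)
  qed
  then have "AE x in lebesgue. \<forall>b\<in>Basis. x \<in> U \<longrightarrow> (g x - h x) \<bullet> b = 0"
    by (intro AE_ball_countable' countable_finite) auto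
  then show ?thesis
    by eventually_elim (metis euclidean_all_zero_iff right_minus_eq)
qed

section \<open>Integration by parts: classical gradients are weak gradients\<close>

lemma integral_lborel_scaled:
  fixes f :: "'a::euclidean_space \<Rightarrow> real"
  assumes [measurable]: "f \<in> borel_measurable borel" and c: "c \<noteq> 0"
  shows "(LINT x|lborel. f x) = \<bar>c\<bar> ^ DIM('a) * (LINT x|lborel. f (t + c *\<^sub>R x))"
  by (subst lborel_affine[OF c, of t]) (simp add: integral_density integral_distr)

lemma integrable_lborel_scaled:
  fixes f :: "'a::euclidean_space \<Rightarrow> real"
  assumes f: "integrable lborel f" and c: "c \<noteq> 0"
  shows "integrable lborel (\<lambda>x. f (t + c *\<^sub>R x))"
proof -
  have [measurable]: "f \<in> borel_measurable borel"
    using f by auto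
  have "integrable (density (distr lborel borel (\<lambda>x. t + c *\<^sub>R x)) (\<lambda>_. \<bar>c\<bar> ^ DIM('a))) f"
    using f lborel_affine[OF c, of t] by simp
  then show ?thesis
    using c by (simp add: integrable_density integrable_distr_eq)
qed

lemma integrable_lborel_compact_support:
  fixes f :: "'a::euclidean_space \<Rightarrow> 'b::euclidean_space"
  assumes "compact K" "continuous_on K f" "\<And>x. x \<notin> K \<Longrightarrow> f x = 0"
  shows "integrable lborel f"
proof -
  have "(\<lambda>x. indicator K x *\<^sub>R f x) = f"
    using assms(3) by (auto simp: indicator_def fun_eq_iff)
  then show ?thesis
    using borel_integrable_compact[OF assms(1,2)] by simp
qed

text \<open>The difference quotients of \<open>F\<close> have integral zero by translation invariance; dominated
  convergence passes to the derivative, which avoids Fubini.\<close>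

lemma integral_derivative_compact_support:
  fixes F :: "'a::euclidean_space \<Rightarrow> real"
  assumes K: "compact K" "\<And>x. x \<notin> K \<Longrightarrow> F x = 0"
    and der: "\<And>x. (F has_derivative (\<lambda>v. G x \<bullet> v)) (at x)"
    and cont: "continuous_on UNIV G"
  shows "(LINT x|lborel. G x \<bullet> v) = 0"
proof -
  have contF: "continuous_on UNIV F"
    by (rule has_derivative_continuous_on[where f' = "\<lambda>x v. G x \<bullet> v"]) (simp add: der)
  obtain R where R: "\<And>x. x \<in> K \<Longrightarrow> norm x \<le> R" "R > 0"
    using compact_imp_bounded[OF K(1)] by (meson bounded_pos)
  have intF: "integrable lborel F"
    using integrable_lborel_compact_support[OF K(1) _ K(2)] contF by (meson continuous_on_subset subset_UNIV)
  \<comment> \<open>K lies in the ball of radius R and steps are at most 1, so \<open>Q n\<close>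
    vanishes outside radius R + |v|. For x inside that radius, \<open>x + h n *\<^sub>R v\<close>
    can reach R + 2|v|, and G must be bounded up to there.\<close>
  define R' where "R' = R + 2 * norm v"
  have "bounded (G ` cball 0 R')"
    by (meson cont compact_cball compact_continuous_image compact_imp_bounded continuous_on_subset subset_UNIV)
  then obtain M where "M > 0" "\<forall>y\<in>G ` cball 0 R'. norm y \<le> M"
    unfolding bounded_pos by blast
  then have M: "\<And>x. norm x \<le> R' \<Longrightarrow> norm (G x) \<le> M" "M > 0"
    by auto
  define h where "h = (\<lambda>n. inverse (real (Suc n)))"
  have h: "0 < h n" "h n \<le> 1" for n
    by (auto simp: h_def inverse_eq_divide)
  have hn: "h \<longlonglongrightarrow> 0"
    unfolding h_def by (rule LIMSEQ_inverse_real_of_nat)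
  define Q where "Q = (\<lambda>n x. (F (x + h n *\<^sub>R v) - F x) / h n)"
  have Fdist: "\<bar>F (x + h n *\<^sub>R v) - F x\<bar> \<le> M * (h n * norm v)" if "norm x \<le> R + norm v" for n x
  proof -
    have "h n * norm v \<le> norm v"
      using h[of n] by (intro mult_left_le_one_le) auto
    then have in_ball: "x + h n *\<^sub>R v \<in> cball 0 R'" "x \<in> cball 0 R'"
      using norm_triangle_ineq[of x "h n *\<^sub>R v"] h(1)[of n] that norm_ge_zero[of v]
      unfolding R'_def mem_cball_0 norm_scaleR by linarith+
    have "norm (F (x + h n *\<^sub>R v) - F x) \<le> M * norm (x + h n *\<^sub>R v - x)"
    proof (rule differentiable_bound[OF convex_cball _ _ in_ball])
      fix y :: 'a assume y: "y \<in> cball 0 R'"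
      show "(F has_derivative (\<lambda>v. G y \<bullet> v)) (at y within cball 0 R')"
        using der by (rule has_derivative_at_withinI)
      show "onorm (\<lambda>v. G y \<bullet> v) \<le> M"
      proof (rule onorm_le)
        fix w
        have "norm (G y \<bullet> w) \<le> norm (G y) * norm w"
          using Cauchy_Schwarz_ineq2 by simp
        also have "\<dots> \<le> M * norm w"
          using M(1) y by (intro mult_right_mono) auto
        finally show "norm (G y \<bullet> w) \<le> M * norm w" .
      qed
    qed
    then show ?thesis using h[of n] by simp
  qed
  have "(\<lambda>n. LINT x|lborel. Q n x) \<longlonglongrightarrow> (LINT x|lborel. G x \<bullet> v)"
  proof (rule integral_dominated_convergence[where w = "\<lambda>x. indicator (cball 0 (R + norm v)) x * (M * norm v)"])
    show "(\<lambda>x. G x \<bullet> v) \<in> borel_measurable lborel"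
      using cont by (auto intro!: borel_measurable_continuous_onI continuous_intros)
    show "Q n \<in> borel_measurable lborel" for n
      unfolding Q_def using contF
      by (auto intro!: borel_measurable_continuous_onI continuous_intros continuous_on_compose2[OF contF] simp: h_def)
    show "integrable lborel (\<lambda>x::'a. indicator (cball 0 (R + norm v)) x * (M * norm v))"
      using emeasure_lborel_cball_finite[of "0::'a" "R + norm v"]
      by (intro integrable_mult_left integrable_real_indicator) auto
    show "AE x in lborel. (\<lambda>n. Q n x) \<longlonglongrightarrow> G x \<bullet> v"
    proof (rule AE_I2)
      fix x
      have "((\<lambda>t. F (x + t *\<^sub>R v)) has_derivative (\<lambda>t. G (x + 0 *\<^sub>R v) \<bullet> (t *\<^sub>R v))) (at 0)"
        by (rule has_derivative_compose[where f = "\<lambda>t. x + t *\<^sub>R v", OF _ der]) (auto intro!: derivative_eq_intros)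
      then have "((\<lambda>t. F (x + t *\<^sub>R v)) has_real_derivative G x \<bullet> v) (at 0)"
        by (simp add: has_field_derivative_def mult_commute_abs)
      then have "((\<lambda>t. (F (x + t *\<^sub>R v) - F x) / t) \<longlongrightarrow> G x \<bullet> v) (at 0)"
        by (simp add: DERIV_def)
      moreover have "filterlim h (at 0) sequentially"
        using hn h(1)[THEN less_imp_neq] by (auto simp: filterlim_at intro!: always_eventually)
      ultimately show "(\<lambda>n. Q n x) \<longlonglongrightarrow> G x \<bullet> v"
        unfolding Q_def by (rule filterlim_compose)
    qed
    show "AE x in lborel. norm (Q n x) \<le> indicator (cball 0 (R + norm v)) x * (M * norm v)" for n
    proof (rule AE_I2)
      fix x
      show "norm (Q n x) \<le> indicator (cball 0 (R + norm v)) x * (M * norm v)"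
      proof (cases "norm x \<le> R + norm v")
        case True
        then show ?thesis
          using Fdist[OF True, of n] h(1)[of n] by (simp add: Q_def abs_divide divide_simps mult.commute mult.left_commute)
      next
        case False
        have "norm x \<le> norm (x + h n *\<^sub>R v) + h n * norm v"
          using norm_triangle_ineq4[of "x + h n *\<^sub>R v" "h n *\<^sub>R v"] h(1)[of n] by simp
        moreover have "h n * norm v \<le> norm v"
          using h[of n] by (intro mult_left_le_one_le) auto
        ultimately have "norm (x + h n *\<^sub>R v) > R" "norm x > R"
          using False norm_ge_zero[of v] by linarith+
        then have "x + h n *\<^sub>R v \<notin> K" "x \<notin> K"
          using R(1) by force+
        then show ?thesis
          using K(2) M(2) by (simp add: Q_def)
      qed
    qed
  qed
  moreover have "(LINT x|lborel. Q n x) = 0" for n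
  proof -
    have shift: "integrable lborel (\<lambda>x. F (h n *\<^sub>R v + x))" "(LINT x|lborel. F (h n *\<^sub>R v + x)) = (LINT x|lborel. F x)"
      using integrable_lborel_scaled[OF intF, of 1] integral_lborel_scaled[of F 1]
        borel_measurable_continuous_onI[OF contF] by simp_all
    then show ?thesis
      unfolding Q_def using intF by (simp add: add.commute)
  qed
  ultimately show ?thesis
    by (simp add: LIMSEQ_const_iff)
qed

lemma locally_integrable_on_continuous:
  fixes f :: "'a::euclidean_space \<Rightarrow> 'b::euclidean_space"
  assumes f: "continuous_on UNIV f" shows "locally_integrable_on f U"
  unfolding locally_integrable_on_def set_integrable_def
proof (intro allI impI)
  fix K assume "compact K \<and> K \<subseteq> U"
  then have "integrable lborel (\<lambda>x. indicator K x *\<^sub>R f x)"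
    using continuous_on_subset[OF f] by (intro borel_integrable_compact) auto
  then show "integrable lebesgue (\<lambda>x. indicator K x *\<^sub>R f x)"
    using borel_measurable_integrable integrable_completion by blast
qed

text \<open>The product of u and a test function is C^1 with compact support, so its directional
  derivative integrates to 0; the product rule splits this into the two sides of the
  identity.\<close>

lemma C1_is_weak_gradient:
  fixes u :: "'a::euclidean_space \<Rightarrow> real"
  assumes der: "\<And>x. (u has_derivative (\<lambda>v. G x \<bullet> v)) (at x)"
    and cont: "continuous_on UNIV G"
  shows "is_weak_gradient U u G"
  unfolding is_weak_gradient_def
proof (intro conjI ballI)
  have contu: "continuous_on UNIV u"
    by (rule has_derivative_continuous_on[where f' = "\<lambda>x v. G x \<bullet> v"]) (simp add: der)
  show "locally_integrable_on u U" "locally_integrable_on G U"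
    using cont contu by (auto intro: locally_integrable_on_continuous)
  fix \<phi> and b :: 'a assume \<phi>: "\<phi> \<in> test_functions U" and b: "b \<in> Basis"
  obtain K M where K: "compact K" "K \<subseteq> U" "\<forall>x. x \<notin> K \<longrightarrow> \<phi> x = 0"
    and M: "\<forall>x. \<bar>\<phi> x\<bar> \<le> M" "0 \<le> M" and c: "continuous_on UNIV \<phi>"
    by (rule test_function_bounded_support[OF \<phi>])
  let ?D = "\<lambda>x v. frechet_derivative \<phi> (at x) v"
  have cd: "cont_diff (Suc 0) \<phi>"
    using \<phi> by (auto simp: test_functions_def)
  have der\<phi>: "(\<phi> has_derivative ?D x) (at x)" for x
    using cd by (simp add: frechet_derivative_works)
  \<comment> \<open>The gradient vector of the test function, so that its derivative takes the inner
    product form used for u.\<close>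
  define H where "H = (\<lambda>x. \<Sum>b\<in>Basis. ?D x b *\<^sub>R b)"
  have H: "?D x v = H x \<bullet> v" for x v
  proof -
    have lin: "linear (?D x)"
      by (rule has_derivative_linear[OF der\<phi>])
    have "?D x v = ?D x (\<Sum>b\<in>Basis. (v \<bullet> b) *\<^sub>R b)"
      by (simp add: euclidean_representation)
    also have "\<dots> = H x \<bullet> v"
      by (simp add: H_def linear_sum[OF lin] linear_scale[OF lin] inner_sum_left inner_sum_right inner_commute mult.commute)
    finally show ?thesis .
  qed
  have contH: "continuous_on UNIV H"
    unfolding H_def using cd by (auto intro!: continuous_intros)
  have H0: "H x = 0" if "x \<notin> K" for x
  proof -
    have "open (- K)" using K(1) by (simp add: compact_imp_closed open_Compl)
    have "(\<phi> has_derivative (\<lambda>_. 0)) (at x)"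
      by (rule has_derivative_transform_within_open[OF has_derivative_const \<open>open (- K)\<close>]) (use that K(3) in auto)
    then have "?D x = (\<lambda>_. 0)"
      using der\<phi> has_derivative_unique by blast
    then show ?thesis by (simp add: H_def)
  qed
  have "(LINT x|lborel. (u x *\<^sub>R H x + \<phi> x *\<^sub>R G x) \<bullet> b) = 0"
  proof (rule integral_derivative_compact_support[OF K(1), where F = "\<lambda>x. u x * \<phi> x"])
    show "((\<lambda>x. u x * \<phi> x) has_derivative (\<lambda>v. (u x *\<^sub>R H x + \<phi> x *\<^sub>R G x) \<bullet> v)) (at x)" for x
      using has_derivative_mult[OF der[of x] der\<phi>[of x]] by (simp add: H inner_add_left mult.commute)
  qed (use K(3) cont contu contH c in \<open>auto intro!: continuous_intros\<close>)
  moreover have "integrable lborel (\<lambda>x. u x * (H x \<bullet> b))"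
    by (rule integrable_lborel_compact_support[OF K(1)])
      (use H0 contu contH in \<open>auto intro!: continuous_intros intro: continuous_on_subset\<close>)
  moreover have "integrable lborel (\<lambda>x. (G x \<bullet> b) * \<phi> x)"
    by (rule integrable_lborel_compact_support[OF K(1)])
      (use K(3) c cont in \<open>auto intro!: continuous_intros intro: continuous_on_subset\<close>)
  ultimately have *: "(LINT x|lborel. u x * (H x \<bullet> b)) = - (LINT x|lborel. (G x \<bullet> b) * \<phi> x)"
    by (simp add: inner_add_left mult.commute[of "\<phi> _"] add_eq_0_iff)
  \<comment> \<open>The support lies in U, so integrals over U may be taken over the whole
    space.\<close>
  have "H x = 0" if "x \<notin> U" for x
    using that H0[of x] K(2) by blast
  then have "(LINT x:U|lebesgue. u x * ?D x b) = (LINT x|lebesgue. u x * (H x \<bullet> b))"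
    unfolding set_lebesgue_integral_def H
    by (intro Bochner_Integration.integral_cong) (auto simp: indicator_def)
  also have "\<dots> = (LINT x|lborel. u x * (H x \<bullet> b))"
    using contu contH
    by (intro integral_completion) (auto intro!: borel_measurable_continuous_onI continuous_intros)
  also have "\<dots> = - (LINT x|lborel. (G x \<bullet> b) * \<phi> x)" by fact
  also have "(LINT x|lborel. (G x \<bullet> b) * \<phi> x) = (LINT x|lebesgue. (G x \<bullet> b) * \<phi> x)"
    using cont c
    by (intro integral_completion[symmetric]) (auto intro!: borel_measurable_continuous_onI continuous_intros)
  also have "\<dots> = (LINT x:U|lebesgue. (G x \<bullet> b) * \<phi> x)"
    unfolding set_lebesgue_integral_def using K
    by (intro Bochner_Integration.integral_cong) (auto simp: indicator_def)
  finally show "(LINT x:U|lebesgue. u x * ?D x b) = - (LINT x:U|lebesgue. (G x \<bullet> b) * \<phi> x)" .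
qed

section \<open>Parabolic Sobolev norms of spatially smooth functions\<close>

lemma set_integrable_bounded_continuous:
  fixes f :: "'a::euclidean_space \<Rightarrow> real"
  assumes f: "continuous_on UNIV f" and U: "open U" "bounded U"
  shows "set_integrable lborel U f"
proof (rule set_integrable_subset)
  show "set_integrable lborel (closure U) f"
    unfolding set_integrable_def
    using U(2) continuous_on_subset[OF f] by (intro borel_integrable_compact) auto
qed (use U(1) closure_subset in auto)

text \<open>The norms are defined with the completed measure, while scaling and measurability of
  parametric integrals are handled in \<open>lborel\<close>; for Borel integrands the two
  agree.\<close>

lemma set_integral_lebesgue_eq_lborel:
  fixes f :: "'a::euclidean_space \<Rightarrow> real"
  assumes "(\<lambda>x. indicator A x *\<^sub>R f x) \<in> borel_measurable borel"
  shows "set_integrable lebesgue A f \<longleftrightarrow> set_integrable lborel A f"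
    and "(LINT x:A|lebesgue. f x) = (LINT x:A|lborel. f x)"
  using assms by (auto simp: set_integrable_def set_lebesgue_integral_def integrable_completion integral_completion)

lemma sobolev_energy_C1:
  fixes u :: "'a::euclidean_space \<Rightarrow> real"
  assumes U: "open U"
    and der: "\<And>x. (u has_derivative (\<lambda>v. G x \<bullet> v)) (at x)"
    and cont: "continuous_on UNIV G"
  shows "sobolev_energy q U u = (LINT x:U|lborel. \<bar>u x\<bar> powr q + norm (G x) powr q)"
proof -
  have contu: "continuous_on UNIV u"
    by (rule has_derivative_continuous_on[where f' = "\<lambda>x v. G x \<bullet> v"]) (simp add: der)
  have [measurable]: "u \<in> borel_measurable borel" "G \<in> borel_measurable borel" "U \<in> sets borel"
    using contu cont U by (auto intro: borel_measurable_continuous_onI)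
  have G: "is_weak_gradient U u G"
    by (rule C1_is_weak_gradient[OF der cont])
  then have "is_weak_gradient U u (weak_gradient U u)"
    unfolding weak_gradient_def by (rule someI[of "is_weak_gradient U u"])
  note ae = is_weak_gradient_unique[OF U G this]
  let ?f = "\<lambda>x. indicator U x *\<^sub>R (\<bar>u x\<bar> powr q + norm (G x) powr q)"
  let ?g = "\<lambda>x. indicator U x *\<^sub>R (\<bar>u x\<bar> powr q + norm (weak_gradient U u x) powr q)"
  have meas: "?f \<in> borel_measurable borel" by measurable
  have f: "?f \<in> borel_measurable lebesgue"
    using meas by (intro measurable_completion) simp
  have eq: "AE x in lebesgue. ?f x = ?g x"
    using ae by eventually_elim (auto simp: indicator_def)
  \<comment> \<open>Nothing is known in advance about the measurability of the chosen
    representative; it is inherited from G by almost everywhere equality because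
    \<open>lebesgue\<close> is complete.\<close>
  then have g: "?g \<in> borel_measurable lebesgue"
    by (rule borel_measurable_AE[OF f])
  have "sobolev_energy q U u = (LINT x:U|lebesgue. \<bar>u x\<bar> powr q + norm (G x) powr q)"
    unfolding sobolev_energy_def set_lebesgue_integral_def
    using integral_cong_AE[OF f g eq] by simp
  also have "\<dots> = (LINT x:U|lborel. \<bar>u x\<bar> powr q + norm (G x) powr q)"
    by (rule set_integral_lebesgue_eq_lborel(2)[OF meas])
  finally show ?thesis .
qed

lemma Lq_on_continuous:
  fixes f :: "'a::euclidean_space \<Rightarrow> 'b::euclidean_space"
  assumes U: "open U" "bounded U" and f: "continuous_on UNIV f" and q: "q > 0"
  shows "f \<in> Lq_on q U"
proof -
  have [measurable]: "f \<in> borel_measurable borel" "U \<in> sets borel"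
    using f U by (auto intro: borel_measurable_continuous_onI)
  have "continuous_on UNIV (\<lambda>x. norm (f x) powr q)"
    using f q by (intro continuous_on_powr' continuous_intros) auto
  then have "set_integrable lborel U (\<lambda>x. norm (f x) powr q)"
    by (rule set_integrable_bounded_continuous[OF _ U])
  then have "set_integrable lebesgue U (\<lambda>x. norm (f x) powr q)"
    by (subst set_integral_lebesgue_eq_lborel(1)) measurable
  moreover have "(\<lambda>x. indicator U x *\<^sub>R f x) \<in> borel_measurable lborel"
    by measurable
  ultimately show ?thesis
    by (auto simp: Lq_on_def set_borel_measurable_def intro!: measurable_completion)
qed

text \<open>A common interface for a single solution and for the difference of two: regularity is
  required only for t > 0, and the integrable h controls the singularity at t = 0.\<close>

lemma parabolic_sobolev_C1:
  fixes u :: "'a::euclidean_space \<Rightarrow> real \<Rightarrow> real"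
  assumes U: "open U" "bounded U" and q: "q > 0"
    and u [measurable]: "(\<lambda>(x, t). u x t) \<in> borel_measurable (borel \<Otimes>\<^sub>M borel)"
    and g [measurable]: "(\<lambda>(x, t). g x t) \<in> borel_measurable (borel \<Otimes>\<^sub>M borel)"
    and der: "\<And>x t. t > 0 \<Longrightarrow> ((\<lambda>x. u x t) has_derivative (\<lambda>v. g x t \<bullet> v)) (at x)"
    and cont: "\<And>t. t > 0 \<Longrightarrow> continuous_on UNIV (\<lambda>x. g x t)"
    and h: "set_integrable lborel {0<..<T} h"
    and bound: "\<And>t. 0 < t \<Longrightarrow> t < T \<Longrightarrow>
      (LINT x:U|lborel. \<bar>u x t\<bar> powr q + norm (g x t) powr q) \<le> h t"
  shows "(\<lambda>t. LINT x:U|lborel. \<bar>u x t\<bar> powr q + norm (g x t) powr q) \<in> borel_measurable borel"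
    and "u \<in> parabolic_sobolev_space q T U"
    and "parabolic_sobolev_norm q T U u =
      (LINT t:{0<..<T}|lborel. LINT x:U|lborel. \<bar>u x t\<bar> powr q + norm (g x t) powr q) powr (1 / q)"
proof -
  have [measurable]: "U \<in> sets borel" using U by auto
  define E where "E = (\<lambda>t. LINT x:U|lborel. \<bar>u x t\<bar> powr q + norm (g x t) powr q)"
  \<comment> \<open>Time is put first because a parametric integral integrates out the second
    component.\<close>
  have "(\<lambda>t. LINT x|lborel. (\<lambda>(t, x). indicator U x *\<^sub>R (\<bar>u x t\<bar> powr q + norm (g x t) powr q)) (t, x)) \<in> borel_measurable borel"
    by (rule lborel.borel_measurable_lebesgue_integral) (simp; measurable)
  then show E [measurable]: "E \<in> borel_measurable borel"
    by (simp add: E_def set_lebesgue_integral_def)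
  have energy: "sobolev_energy q U (\<lambda>x. u x t) = E t" if "t > 0" for t
    unfolding E_def by (rule sobolev_energy_C1[OF U(1) der[OF that] cont[OF that]])
  have E0: "0 \<le> E t" for t
    by (simp add: E_def set_lebesgue_integral_def)
  have "set_integrable lborel {0<..<T} E"
  proof (rule set_integrable_bound[OF h])
    show "set_borel_measurable lborel {0<..<T} E"
      unfolding set_borel_measurable_def by measurable
    show "AE t in lborel. t \<in> {0<..<T} \<longrightarrow> norm (E t) \<le> norm (h t)"
    proof (intro AE_I2 impI)
      fix t assume "t \<in> {0<..<T}"
      then have "E t \<le> h t" by (auto simp: E_def bound)
      then show "norm (E t) \<le> norm (h t)" using E0[of t] by simp
    qed
  qed
  moreover have Em: "(\<lambda>t. indicator {0<..<T} t *\<^sub>R E t) \<in> borel_measurable borel"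
    by measurable
  ultimately have "set_integrable lebesgue {0<..<T} E"
    using set_integral_lebesgue_eq_lborel(1) by blast
  moreover have "set_integrable lebesgue {0<..<T} E \<longleftrightarrow> set_integrable lebesgue {0<..<T} (\<lambda>t. sobolev_energy q U (\<lambda>x. u x t))"
    by (rule set_integrable_cong) (auto simp: energy)
  ultimately have int: "set_integrable lebesgue {0<..<T} (\<lambda>t. sobolev_energy q U (\<lambda>x. u x t))"
    by simp
  have "(LINT t:{0<..<T}|lebesgue. sobolev_energy q U (\<lambda>x. u x t)) = (LINT t:{0<..<T}|lebesgue. E t)"
    by (rule set_lebesgue_integral_cong) (auto simp: energy)
  also have "\<dots> = (LINT t:{0<..<T}|lborel. E t)"
    by (rule set_integral_lebesgue_eq_lborel(2)[OF Em])
  finally show "parabolic_sobolev_norm q T U u = (LINT t:{0<..<T}|lborel. E t) powr (1 / q)"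
    by (simp add: parabolic_sobolev_norm_def)
  have sob: "(\<lambda>x. u x t) \<in> sobolev_space q U" if "t > 0" for t
  proof -
    have "continuous_on UNIV (\<lambda>x. u x t)"
      by (rule has_derivative_continuous_on[where f' = "\<lambda>x v. g x t \<bullet> v"]) (simp add: der that)
    then show ?thesis
      unfolding sobolev_space_def
      using C1_is_weak_gradient[OF der[OF that] cont[OF that]] cont[OF that] U q
      by (auto intro!: Lq_on_continuous bexI[of _ "\<lambda>x. g x t"])
  qed
  have "(\<lambda>z. indicator (U \<times> {0<..<T}) z *\<^sub>R (\<lambda>(x, t). u x t) z) \<in> borel_measurable (borel \<Otimes>\<^sub>M borel)"
    by measurable
  then have "set_borel_measurable lebesgue (U \<times> {0<..<T}) (\<lambda>(x, t). u x t)"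
    unfolding set_borel_measurable_def by (intro measurable_completion) (simp add: borel_prod)
  then show "u \<in> parabolic_sobolev_space q T U"
    using sob int by (auto simp: parabolic_sobolev_space_def)
qed

section \<open>Mass and regularity of the Barenblatt solution\<close>

text \<open>At the kink the difference quotient is at most |h|^(a-1), which tends to 0 because a >
  1. Applied with a = (p-1)/(p-2), this handles the free boundary.\<close>

lemma DERIV_max_powr:
  fixes a :: real
  assumes a: "a > 1"
  shows "((\<lambda>y. max 0 y powr a) has_real_derivative a * max 0 y powr (a - 1)) (at y)"
proof (cases y "0 :: real" rule: linorder_cases)
  case less
  have ev: "\<forall>\<^sub>F z in nhds y. max 0 z powr a = 0"
    by (rule eventually_mono[OF eventually_nhds_in_open[of "{..<0}"]]) (use less in auto)
  show ?thesis
    using less by (subst DERIV_cong_ev[OF refl ev refl]) simp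
next
  case greater
  have ev: "\<forall>\<^sub>F z in nhds y. max 0 z powr a = z powr a"
    by (rule eventually_mono[OF eventually_nhds_in_open[of "{0<..}"]]) (use greater in auto)
  have "((\<lambda>z. z powr a) has_real_derivative a * max 0 y powr (a - 1)) (at y)"
    using greater has_real_derivative_powr[of y a] by simp
  then show ?thesis
    by (subst DERIV_cong_ev[OF refl ev refl])
next
  case equal
  have "((\<lambda>h. \<bar>h\<bar> powr (a - 1)) \<longlongrightarrow> \<bar>0\<bar> powr (a - 1)) (at (0::real))"
    using a by (intro tendsto_powr' tendsto_intros) auto
  then have lim: "((\<lambda>h. \<bar>h\<bar> powr (a - 1)) \<longlongrightarrow> 0) (at (0::real))"
    by simp
  have "norm (max 0 h powr a / h) \<le> \<bar>h\<bar> powr (a - 1)" for h :: real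
    by (cases h "0 :: real" rule: linorder_cases) (auto simp: powr_diff intro: divide_nonneg_neg)
  then have "((\<lambda>h. max 0 h powr a / h) \<longlongrightarrow> 0) (at (0::real))"
    by (intro Lim_null_comparison[OF _ lim] always_eventually allI)
  then show ?thesis
    using equal by (simp add: DERIV_def)
qed

text \<open>Away from the origin this is the chain rule through the norm. At the origin division by
  zero makes the formula 0, and this is the true derivative because |h|^b = o(|h|) for b >
  1.\<close>

lemma has_derivative_norm_powr:
  fixes x :: "'a::euclidean_space"
  assumes b: "b > 1"
  shows "((\<lambda>x. norm x powr b) has_derivative (\<lambda>v. b * norm x powr (b - 1) / norm x * (x \<bullet> v))) (at x)"
proof (cases "x = 0")
  case False
  have "((\<lambda>x. norm x powr b) has_derivative (\<lambda>v. b * norm x powr (b - 1) * (v \<bullet> sgn x))) (at x)"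
    by (rule has_derivative_compose[where f = norm and g = "\<lambda>y. y powr b" and g' = "(*) _", OF has_derivative_norm[OF False]])
      (use False has_real_derivative_powr[of "norm x" b] in \<open>simp_all add: has_field_derivative_def\<close>)
  then show ?thesis
    by (simp add: sgn_div_norm divide_inverse inner_commute mult_ac)
next
  case True
  have "((\<lambda>h::'a. norm h powr (b - 1)) \<longlongrightarrow> norm (0::'a) powr (b - 1)) (at 0)"
    using b by (intro tendsto_powr' tendsto_intros) auto
  then have lim: "((\<lambda>h::'a. norm h powr (b - 1)) \<longlongrightarrow> 0) (at 0)"
    by simp
  have "((\<lambda>h::'a. norm h powr b / norm h) \<longlongrightarrow> 0) (at 0)"
    by (rule Lim_transform_eventually[OF lim]) (auto simp: eventually_at_filter powr_diff)
  then show ?thesis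
    using True by (auto simp: has_derivative_def bounded_linear_zero netlimit_at divide_inverse mult.commute)
qed

text \<open>The length of this field is at most |x|^b, so the discontinuity of the direction x/|x|
  at the origin is damped.\<close>

lemma continuous_on_norm_powr_direction:
  assumes b: "b > 0"
  shows "continuous_on UNIV (\<lambda>x::'a::euclidean_space. (norm x powr b / norm x) *\<^sub>R x)"
proof -
  have "isCont (\<lambda>x::'a. (norm x powr b / norm x) *\<^sub>R x) x" for x
  proof (cases "x = 0")
    case False
    then show ?thesis by (intro continuous_intros) auto
  next
    case True
    have "((\<lambda>h::'a. norm h powr b) \<longlongrightarrow> norm (0::'a) powr b) (at 0)"
      using b by (intro tendsto_powr' tendsto_intros) auto
    then have lim: "((\<lambda>h::'a. norm h powr b) \<longlongrightarrow> 0) (at 0)"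
      by simp
    have "((\<lambda>x::'a. (norm x powr b / norm x) *\<^sub>R x) \<longlongrightarrow> 0) (at 0)"
      by (rule Lim_null_comparison[OF _ lim]) (auto intro!: always_eventually)
    then show ?thesis
      using True by (simp add: isCont_def)
  qed
  then show ?thesis by (simp add: continuous_at_imp_continuous_on)
qed

section \<open>The unit profile, its mass and the constant C(n,p)\<close>

abbreviation lam :: "'a::euclidean_space itself \<Rightarrow> real \<Rightarrow> real" where
  "lam d p \<equiv> barenblatt_lambda DIM('a) p"

definition kap :: "'a::euclidean_space itself \<Rightarrow> real \<Rightarrow> real" where
  "kap d p = (p - 2) / p * lam TYPE('a) p powr (1 / (1 - p))"

lemma lam_pos: "p > 2 \<Longrightarrow> lam TYPE('a::euclidean_space) p > 0"
  unfolding barenblatt_lambda_def by (auto intro!: add_nonneg_pos)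

lemma kap_pos: "p > 2 \<Longrightarrow> kap TYPE('a::euclidean_space) p > 0"
  using lam_pos[of p, where 'a = 'a] by (simp add: kap_def)

lemma barenblatt_profile_eq:
  "barenblatt_profile C p (x::'a::euclidean_space) t =
     t powr (- real DIM('a) / lam TYPE('a) p) *
     max 0 (C - kap TYPE('a) p * (norm x / t powr (1 / lam TYPE('a) p)) powr (p / (p - 1)))
       powr ((p - 1) / (p - 2))"
  by (simp add: barenblatt_profile_def kap_def Let_def)

text \<open>The profile at t = 1 with C = 1. It does not involve the normalizing constant, which can
  therefore be computed from its mass.\<close>

definition unit_profile :: "real \<Rightarrow> 'a::euclidean_space \<Rightarrow> real" where
  "unit_profile p x = max 0 (1 - kap TYPE('a) p * norm x powr (p / (p - 1))) powr ((p - 1) / (p - 2))"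

lemma unit_profile_measurable [measurable]: "unit_profile p \<in> borel_measurable borel"
  unfolding unit_profile_def by measurable

lemma unit_profile_bounds:
  assumes "p > 2"
  shows "0 \<le> unit_profile p x" "unit_profile p (x::'a::euclidean_space) \<le> 1"
proof -
  show "0 \<le> unit_profile p x" by (simp add: unit_profile_def)
  have "max 0 (1 - kap TYPE('a) p * norm x powr (p / (p - 1))) \<le> 1"
    using kap_pos[OF assms, where 'a = 'a] by simp
  then show "unit_profile p (x::'a) \<le> 1"
    unfolding unit_profile_def using assms by (intro powr_le1) auto
qed

lemma less_powr_iff_root:
  fixes b :: real
  assumes "b > 0" "0 \<le> r" "0 \<le> y"
  shows "r powr (1 / b) < y \<longleftrightarrow> r < y powr b"
proof -
  have "r powr (1 / b) < y \<longleftrightarrow> (r powr (1 / b)) powr b < y powr b"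
    using assms powr_less_mono2[of b "r powr (1 / b)" y] powr_mono2[of b y "r powr (1 / b)"] by force
  then show ?thesis
    using assms by (simp add: powr_powr)
qed

lemma unit_profile_eq_0:
  assumes p: "p > 2" and x: "(1 / kap TYPE('a) p) powr (1 / (p / (p - 1))) < norm (x::'a::euclidean_space)"
  shows "unit_profile p x = 0"
proof -
  have "1 / kap TYPE('a) p < norm x powr (p / (p - 1))"
    using x p kap_pos[OF p, where 'a = 'a] by (subst (asm) less_powr_iff_root) auto
  then have "1 < kap TYPE('a) p * norm x powr (p / (p - 1))"
    using kap_pos[OF p, where 'a = 'a] by (simp add: field_simps)
  then show ?thesis
    by (simp add: unit_profile_def)
qed

lemma integrable_unit_profile:
  assumes p: "p > 2"
  shows "integrable lborel (unit_profile p :: 'a::euclidean_space \<Rightarrow> real)"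
proof -
  define R where "R = (1 / kap TYPE('a) p) powr (1 / (p / (p - 1)))"
  have "integrable lborel (\<lambda>x::'a. indicator (cball 0 R) x :: real)"
    using emeasure_lborel_cball_finite[of "0::'a" R] by (intro integrable_real_indicator) auto
  then show ?thesis
  proof (rule Bochner_Integration.integrable_bound)
    show "AE x in lborel. norm (unit_profile p (x::'a)) \<le> norm (indicator (cball 0 R) x :: real)"
      using unit_profile_bounds[OF p, where 'a = 'a] unit_profile_eq_0[OF p, where 'a = 'a]
      by (auto simp: indicator_def R_def not_le)
  qed simp
qed

definition unit_mass :: "'a::euclidean_space itself \<Rightarrow> real \<Rightarrow> real" where
  "unit_mass d p = (LINT x|lborel. unit_profile p (x::'a))"

lemma unit_mass_pos:
  assumes p: "p > 2" shows "unit_mass TYPE('a::euclidean_space) p > 0"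
proof -
  \<comment> \<open>At this radius kap * r^(p/(p-1)) equals 1/2, so the bracket is at least 1/2 on
    the ball and the profile dominates a positive constant there.\<close>
  define \<delta> where "\<delta> = (1 / (2 * kap TYPE('a) p)) powr (1 / (p / (p - 1)))"
  have k: "kap TYPE('a) p > 0" by (rule kap_pos[OF p])
  then have \<delta>: "\<delta> > 0" by (simp add: \<delta>_def)
  have "(1 / 2) powr ((p - 1) / (p - 2)) * indicator (cball 0 \<delta>) x \<le> unit_profile p x" for x :: 'a
  proof (cases "norm x \<le> \<delta>")
    case True
    then have "norm x powr (p / (p - 1)) \<le> 1 / (2 * kap TYPE('a) p)"
      using less_powr_iff_root[of "p / (p - 1)" "1 / (2 * kap TYPE('a) p)" "norm x"] p k
      by (simp add: \<delta>_def not_less[symmetric])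
    then have "kap TYPE('a) p * norm x powr (p / (p - 1)) \<le> 1 / 2"
      using k by (simp add: field_simps)
    then show ?thesis
      using True p by (auto simp: unit_profile_def intro!: powr_mono2)
  qed (use unit_profile_bounds[OF p] in auto)
  moreover have int: "integrable lborel (\<lambda>x::'a. (1 / 2) powr ((p - 1) / (p - 2)) * indicator (cball 0 \<delta>) x :: real)"
    using emeasure_lborel_cball_finite[of "0::'a" \<delta>] by (intro integrable_mult_right integrable_real_indicator) auto
  ultimately have "(LINT x|lborel. (1 / 2) powr ((p - 1) / (p - 2)) * indicator (cball 0 \<delta>) (x::'a)) \<le> unit_mass TYPE('a) p"
    unfolding unit_mass_def by (intro integral_mono integrable_unit_profile p)
  moreover have "measure lborel (cball (0::'a) \<delta>) > 0"
    using content_cball_pos[OF \<delta>] by simp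
  then have "0 < (LINT x|lborel. (1 / 2) powr ((p - 1) / (p - 2)) * indicator (cball 0 \<delta>) (x::'a))"
    by simp
  ultimately show ?thesis by linarith
qed

text \<open>The power of C by which the mass scales: (p-1)/(p-2) comes from the height, and n times
  the exponent (p-1)/p of the radius comes from the volume.\<close>

definition mass_exponent :: "'a::euclidean_space itself \<Rightarrow> real \<Rightarrow> real" where
  "mass_exponent d p = (p - 1) / (p - 2) + real DIM('a) / (p / (p - 1))"

lemma mass_exponent_pos: "p > 2 \<Longrightarrow> mass_exponent TYPE('a::euclidean_space) p > 0"
  by (auto simp: mass_exponent_def intro!: add_pos_nonneg)

text \<open>Pulling C out of the bracket leaves 1 - kap * (r / C^(1/b))^b with b = p/(p-1) and r =
  |x| / t^(1/\<lambda>), so C acts as a change of height and of length scale.\<close>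

lemma barenblatt_profile_unit_profile:
  fixes x :: "'a::euclidean_space"
  assumes p: "p > 2" and C: "C > 0" and t: "t > 0"
  shows "barenblatt_profile C p x t =
    t powr (- real DIM('a) / lam TYPE('a) p) * C powr ((p - 1) / (p - 2)) *
      unit_profile p ((1 / (t powr (1 / lam TYPE('a) p) * C powr (1 / (p / (p - 1))))) *\<^sub>R x)"
proof -
  define s where "s = t powr (1 / lam TYPE('a) p)"
  define \<beta> where "\<beta> = p / (p - 1)"
  have pos: "s > 0" "\<beta> > 0" using t p by (auto simp: s_def \<beta>_def)
  have "norm ((1 / (s * C powr (1 / \<beta>))) *\<^sub>R x) = (norm x / s) / C powr (1 / \<beta>)"
    using pos C by simp
  then have "norm ((1 / (s * C powr (1 / \<beta>))) *\<^sub>R x) powr \<beta> = (norm x / s) powr \<beta> / C"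
    using pos C by (simp add: powr_divide powr_mult powr_powr)
  then have "C - kap TYPE('a) p * (norm x / s) powr \<beta> = C * (1 - kap TYPE('a) p * norm ((1 / (s * C powr (1 / \<beta>))) *\<^sub>R x) powr \<beta>)"
    using C by (simp add: field_simps)
  moreover have "max 0 (C * y) powr r = C powr r * max 0 y powr r" for y r
    using C by (simp add: max_def powr_mult zero_le_mult_iff)
  ultimately show ?thesis
    unfolding barenblatt_profile_eq unit_profile_def s_def[symmetric] \<beta>_def[symmetric] by simp
qed

text \<open>The height factor t^(-n/\<lambda>) cancels the Jacobian t^(n/\<lambda>), so the mass is
  independent of t and one C can serve all times.\<close>

lemma barenblatt_profile_mass:
  assumes p: "p > 2" and C: "C > 0" and t: "t > 0"
  shows "has_bochner_integral lebesgue (\<lambda>x::'a::euclidean_space. barenblatt_profile C p x t)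
    (C powr mass_exponent TYPE('a) p * unit_mass TYPE('a) p)"
proof -
  define c where "c = t powr (1 / lam TYPE('a) p) * C powr (1 / (p / (p - 1)))"
  define A where "A = t powr (- real DIM('a) / lam TYPE('a) p) * C powr ((p - 1) / (p - 2))"
  have c: "c > 0" using t C by (simp add: c_def)
  have eq: "(\<lambda>x::'a. barenblatt_profile C p x t) = (\<lambda>x. A * unit_profile p ((1 / c) *\<^sub>R x))"
    using barenblatt_profile_unit_profile[OF assms, where 'a = 'a] by (auto simp: c_def A_def)
  have int: "integrable lborel (\<lambda>x::'a. A * unit_profile p ((1 / c) *\<^sub>R x))"
    using integrable_lborel_scaled[OF integrable_unit_profile[OF p, where 'a = 'a], of "1 / c" 0] c by simp
  have "(LINT x|lborel. unit_profile p ((1 / c) *\<^sub>R (x::'a))) = c ^ DIM('a) * unit_mass TYPE('a) p"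
    using integral_lborel_scaled[of "unit_profile p :: 'a \<Rightarrow> real" "1 / c" 0] c
    by (simp add: unit_mass_def field_simps)
  moreover have "A * c ^ DIM('a) = C powr mass_exponent TYPE('a) p"
    using t C by (simp add: A_def c_def power_mult_distrib powr_realpow[symmetric] powr_powr mass_exponent_def powr_add[symmetric] powr_minus)
      (simp add: powr_minus field_simps powr_add)
  ultimately have "(LINT x|lborel. A * unit_profile p ((1 / c) *\<^sub>R (x::'a))) = C powr mass_exponent TYPE('a) p * unit_mass TYPE('a) p"
    by (simp add: mult.assoc[symmetric])
  then show ?thesis
    unfolding eq has_bochner_integral_iff using int
    by (simp add: integrable_completion integral_completion)
qed

text \<open>The mass is a positive power of C times a positive number, so mass 1 has exactly one
  positive root; hence the definite description in \<open>barenblatt_const\<close> denotes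
  it.\<close>

lemma barenblatt_const_eq:
  assumes p: "p > 2"
  shows "barenblatt_const TYPE('a::euclidean_space) p =
    (1 / unit_mass TYPE('a) p) powr (1 / mass_exponent TYPE('a) p)"
proof -
  let ?e = "mass_exponent TYPE('a) p" and ?I = "unit_mass TYPE('a) p"
  have pos: "?e > 0" "?I > 0"
    using mass_exponent_pos unit_mass_pos p by auto
  have "(C > 0 \<and> (\<forall>t>0. has_bochner_integral lebesgue (\<lambda>x::'a. barenblatt_profile C p x t) 1)) \<longleftrightarrow>
      C = (1 / ?I) powr (1 / ?e)" for C
  proof
    assume C: "C > 0 \<and> (\<forall>t>0. has_bochner_integral lebesgue (\<lambda>x::'a. barenblatt_profile C p x t) 1)"
    then have "C powr ?e * ?I = 1"
      using has_bochner_integral_eq[OF barenblatt_profile_mass[OF p, of C 1, where 'a = 'a]] by simp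
    then have "1 / ?I = C powr ?e"
      using pos by (simp add: field_simps)
    then show "C = (1 / ?I) powr (1 / ?e)"
      using C pos by (simp add: powr_powr)
  next
    assume C: "C = (1 / ?I) powr (1 / ?e)"
    then have "C > 0" "C powr ?e * ?I = 1"
      using pos by (auto simp: powr_powr)
    then show "C > 0 \<and> (\<forall>t>0. has_bochner_integral lebesgue (\<lambda>x::'a. barenblatt_profile C p x t) 1)"
      using barenblatt_profile_mass[OF p, of C, where 'a = 'a] by simp
  qed
  then show ?thesis
    unfolding barenblatt_const_def by simp
qed

lemma barenblatt_const_pos: "p > 2 \<Longrightarrow> barenblatt_const TYPE('a::euclidean_space) p > 0"
  using unit_mass_pos[of p, where 'a = 'a] by (simp add: barenblatt_const_eq)

section \<open>The classical gradient in space\<close>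

text \<open>At \<open>x = 0\<close> the factor \<open>1 / norm x\<close> is the junk value \<open>0\<close>, which agrees with the true gradient there.\<close>

definition barenblatt_gradient :: "real \<Rightarrow> 'a::euclidean_space \<Rightarrow> real \<Rightarrow> 'a" where
  "barenblatt_gradient p x t =
     (- (t powr (- real DIM('a) / lam TYPE('a) p) / t powr (1 / lam TYPE('a) p) *
         (p / (p - 2) * kap TYPE('a) p) *
         max 0 (barenblatt_const TYPE('a) p - kap TYPE('a) p * (norm x / t powr (1 / lam TYPE('a) p)) powr (p / (p - 1)))
           powr (1 / (p - 2)) *
         ((norm x / t powr (1 / lam TYPE('a) p)) powr (1 / (p - 1)) / norm x))) *\<^sub>R x"

lemma barenblatt_eq:
  "barenblatt p (x::'a::euclidean_space) t =
     t powr (- real DIM('a) / lam TYPE('a) p) *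
     max 0 (barenblatt_const TYPE('a) p - kap TYPE('a) p * (norm x / t powr (1 / lam TYPE('a) p)) powr (p / (p - 1)))
       powr ((p - 1) / (p - 2))"
  by (simp add: barenblatt_def barenblatt_profile_eq)

text \<open>Chain rule through |x/s|^b and the truncated power of exponent a, with s =
  t^(1/\<lambda>). The coefficient p/(p-2) of the gradient is the product a b.\<close>

lemma barenblatt_has_derivative:
  fixes x :: "'a::euclidean_space"
  assumes p: "p > 2" and t: "t > 0"
  shows "((\<lambda>x. barenblatt p x t) has_derivative (\<lambda>v. barenblatt_gradient p x t \<bullet> v)) (at x)"
proof -
  define s where "s = t powr (1 / lam TYPE('a) p)"
  define A where "A = t powr (- real DIM('a) / lam TYPE('a) p)"
  define k where "k = kap TYPE('a) p"
  define C where "C = barenblatt_const TYPE('a) p"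
  have s: "s > 0" using t by (simp add: s_def)
  define a where "a = (p - 1) / (p - 2)"
  define b where "b = p / (p - 1)"
  have ab: "a > 1" "b > 1" "a - 1 = 1 / (p - 2)" "b - 1 = 1 / (p - 1)"
    using p by (auto simp: a_def b_def field_simps)
  have ab': "a * b = p / (p - 2)"
    using p by (simp add: a_def b_def)
  define y where "y = C - k * norm (x /\<^sub>R s) powr b"
  have 1: "((\<lambda>x. norm (x /\<^sub>R s) powr b) has_derivative
      (\<lambda>v. b * norm (x /\<^sub>R s) powr (b - 1) / norm (x /\<^sub>R s) * ((x /\<^sub>R s) \<bullet> (v /\<^sub>R s)))) (at x)"
    by (rule has_derivative_compose[OF _ has_derivative_norm_powr[OF ab(2)]]) (auto intro!: derivative_eq_intros)
  have 2: "((\<lambda>x. C - k * norm (x /\<^sub>R s) powr b) has_derivative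
      (\<lambda>v. - (k * (b * norm (x /\<^sub>R s) powr (b - 1) / norm (x /\<^sub>R s) * ((x /\<^sub>R s) \<bullet> (v /\<^sub>R s)))))) (at x)"
    by (rule derivative_eq_intros 1 refl)+ simp
  have 3: "((\<lambda>x. max 0 (C - k * norm (x /\<^sub>R s) powr b) powr a) has_derivative
      (\<lambda>v. a * max 0 y powr (a - 1) *
         (- (k * (b * norm (x /\<^sub>R s) powr (b - 1) / norm (x /\<^sub>R s) * ((x /\<^sub>R s) \<bullet> (v /\<^sub>R s))))))) (at x)"
    unfolding y_def
    by (rule has_derivative_compose[where g = "\<lambda>y. max 0 y powr a", OF 2 DERIV_max_powr[OF ab(1), unfolded has_field_derivative_def]])
  have "((\<lambda>x. A * max 0 (C - k * norm (x /\<^sub>R s) powr b) powr a) has_derivative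
      (\<lambda>v. A * (a * max 0 y powr (a - 1) *
         (- (k * (b * norm (x /\<^sub>R s) powr (b - 1) / norm (x /\<^sub>R s) * ((x /\<^sub>R s) \<bullet> (v /\<^sub>R s)))))))) (at x)"
    by (rule has_derivative_mult_right[OF 3])
  moreover have "(\<lambda>x. A * max 0 (C - k * norm (x /\<^sub>R s) powr b) powr a) = (\<lambda>x::'a. barenblatt p x t)"
    using s by (simp add: fun_eq_iff barenblatt_eq A_def s_def k_def C_def a_def b_def divide_inverse mult.commute)
  moreover have "A * (a * max 0 y powr (a - 1) *
         (- (k * (b * norm (x /\<^sub>R s) powr (b - 1) / norm (x /\<^sub>R s) * ((x /\<^sub>R s) \<bullet> (v /\<^sub>R s)))))) = barenblatt_gradient p x t \<bullet> v" for v
  proof -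
    have n: "norm (x /\<^sub>R s) = norm x / s"
      using s by (simp add: divide_inverse mult.commute)
    have "barenblatt_gradient p x t \<bullet> v = - (A / s * (a * b * k) * max 0 y powr (a - 1) * ((norm x / s) powr (b - 1) / norm x)) * (x \<bullet> v)"
      unfolding barenblatt_gradient_def y_def n s_def[symmetric] A_def[symmetric] k_def[symmetric] C_def[symmetric]
        b_def[symmetric] ab(3,4)[symmetric] ab'[symmetric] by simp
    \<comment> \<open>Stated for arbitrary numbers, so that \<open>nx = 0\<close> is covered; both
      sides are then 0.\<close>
    moreover have "A * (a * z * (- (k * (b * r / (nx / s) * (w / s / s))))) = - (A / s * (a * b * k) * z * (r / nx)) * w" for z r nx w
      by (simp add: mult_ac)
    moreover have "(x /\<^sub>R s) \<bullet> (v /\<^sub>R s) = (x \<bullet> v) / s / s"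
      by (simp add: divide_inverse mult_ac)
    ultimately show ?thesis
      unfolding n by simp
  qed
  ultimately show ?thesis by simp
qed

lemma continuous_on_barenblatt_gradient:
  assumes p: "p > 2" and t: "t > 0"
  shows "continuous_on UNIV (\<lambda>x::'a::euclidean_space. barenblatt_gradient p x t)"
proof -
  define s where "s = t powr (1 / lam TYPE('a) p)"
  define k where "k = kap TYPE('a) p"
  define C where "C = barenblatt_const TYPE('a) p"
  have s: "s > 0" using t by (simp add: s_def)
  \<comment> \<open>Regrouped so that the only singular factor is the field |x|^(1/(p-1)) x/|x|,
    whose continuity is known.\<close>
  have "continuous_on UNIV (\<lambda>x::'a. (- (t powr (- real DIM('a) / lam TYPE('a) p) / s * (p / (p - 2) * k) *
      max 0 (C - k * (norm x / s) powr (p / (p - 1))) powr (1 / (p - 2)))) *\<^sub>R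
        ((1 / s powr (1 / (p - 1))) *\<^sub>R ((norm x powr (1 / (p - 1)) / norm x) *\<^sub>R x)))"
    using p s
    by (intro continuous_on_scaleR[OF _ continuous_on_scaleR[OF continuous_on_const continuous_on_norm_powr_direction]]
        continuous_on_minus continuous_on_mult[OF continuous_on_const] continuous_on_powr' continuous_intros) auto
  then show ?thesis
    using s by (simp add: barenblatt_gradient_def s_def k_def C_def powr_divide mult.assoc)
qed

lemma barenblatt_measurable [measurable]:
  "(\<lambda>(x::'a::euclidean_space, t). barenblatt p x t) \<in> borel_measurable (borel \<Otimes>\<^sub>M borel)"
  unfolding barenblatt_eq by measurable

lemma barenblatt_gradient_measurable [measurable]:
  "(\<lambda>(x::'a::euclidean_space, t). barenblatt_gradient p x t) \<in> borel_measurable (borel \<Otimes>\<^sub>M borel)"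
  unfolding barenblatt_gradient_def by measurable

section \<open>Self-similar pointwise bounds\<close>

text \<open>The radius of the support at t = 1, where the bracket vanishes.\<close>

definition barenblatt_radius :: "'a::euclidean_space itself \<Rightarrow> real \<Rightarrow> real" where
  "barenblatt_radius d p = (barenblatt_const TYPE('a) p / kap TYPE('a) p) powr (1 / (p / (p - 1)))"

text \<open>A bound at t = 1 for the solution and its gradient together: the first summand takes the
  bracket at its maximum C, the second also takes |x| at the support radius.\<close>

definition barenblatt_bound :: "'a::euclidean_space itself \<Rightarrow> real \<Rightarrow> real" where
  "barenblatt_bound d p = barenblatt_const TYPE('a) p powr ((p - 1) / (p - 2)) +
     p / (p - 2) * kap TYPE('a) p * barenblatt_const TYPE('a) p powr (1 / (p - 2)) *
       barenblatt_radius TYPE('a) p powr (1 / (p - 1))"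

lemma barenblatt_cutoff:
  fixes x :: "'a::euclidean_space"
  assumes p: "p > 2" and s: "s > 0" and x: "barenblatt_radius TYPE('a) p * s < norm x"
  shows "max 0 (barenblatt_const TYPE('a) p - kap TYPE('a) p * (norm x / s) powr (p / (p - 1))) = 0"
proof -
  have k: "kap TYPE('a) p > 0" and C: "barenblatt_const TYPE('a) p > 0"
    using kap_pos barenblatt_const_pos p by auto
  have "barenblatt_radius TYPE('a) p < norm x / s"
    using x s by (simp add: field_simps)
  then have "barenblatt_const TYPE('a) p / kap TYPE('a) p < (norm x / s) powr (p / (p - 1))"
    unfolding barenblatt_radius_def using p k C s by (subst (asm) less_powr_iff_root) auto
  then show ?thesis
    using k by (simp add: field_simps)
qed

text \<open>Everything depends on x only through x / t^(1/\<lambda>), so one space derivative costs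
  another factor t^(-1/\<lambda>). This is the origin of n + 1 in place of n.\<close>

lemma barenblatt_bounds:
  fixes x :: "'a::euclidean_space"
  assumes p: "p > 2" and t: "t > 0"
  defines "ball_ind \<equiv> indicator (cball 0 (barenblatt_radius TYPE('a) p * t powr (1 / lam TYPE('a) p))) x"
  shows "\<bar>barenblatt p x t\<bar> \<le> t powr (- real DIM('a) / lam TYPE('a) p) * barenblatt_bound TYPE('a) p * ball_ind"
    and "norm (barenblatt_gradient p x t) \<le>
      t powr (- (real DIM('a) + 1) / lam TYPE('a) p) * barenblatt_bound TYPE('a) p * ball_ind"
proof -
  define s where "s = t powr (1 / lam TYPE('a) p)"
  define R where "R = barenblatt_radius TYPE('a) p"
  define k where "k = kap TYPE('a) p"
  define C where "C = barenblatt_const TYPE('a) p"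
  define m where "m = max 0 (C - k * (norm x / s) powr (p / (p - 1)))"
  define G where "G = p / (p - 2) * k * C powr (1 / (p - 2)) * R powr (1 / (p - 1))"
  have s: "s > 0" using t by (simp add: s_def)
  have k: "k > 0" and C: "C > 0"
    using kap_pos barenblatt_const_pos p by (auto simp: k_def C_def)
  have M: "barenblatt_bound TYPE('a) p = C powr ((p - 1) / (p - 2)) + G"
    by (simp add: barenblatt_bound_def C_def k_def R_def G_def)
  have G0: "G \<ge> 0" using k p by (simp add: G_def)
  have m: "0 \<le> m" "m \<le> C"
    using k C by (auto simp: m_def)
  have B: "barenblatt p x t = t powr (- real DIM('a) / lam TYPE('a) p) * m powr ((p - 1) / (p - 2))"
    by (simp add: barenblatt_eq m_def C_def k_def s_def)
  have ts: "t powr (- real DIM('a) / lam TYPE('a) p) / s = t powr (- (real DIM('a) + 1) / lam TYPE('a) p)"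
    by (simp add: s_def powr_diff[symmetric] diff_divide_distrib add_divide_distrib)
  have "norm (barenblatt_gradient p x t) = t powr (- real DIM('a) / lam TYPE('a) p) / s *
      (p / (p - 2) * k * m powr (1 / (p - 2)) * (if x = 0 then 0 else (norm x / s) powr (1 / (p - 1))))"
    using p k s by (simp add: barenblatt_gradient_def m_def C_def k_def s_def abs_mult)
  then have Gr: "norm (barenblatt_gradient p x t) = t powr (- (real DIM('a) + 1) / lam TYPE('a) p) *
      (p / (p - 2) * k * m powr (1 / (p - 2)) * (if x = 0 then 0 else (norm x / s) powr (1 / (p - 1))))"
    unfolding ts .
  show "\<bar>barenblatt p x t\<bar> \<le> t powr (- real DIM('a) / lam TYPE('a) p) * barenblatt_bound TYPE('a) p * ball_ind"
    "norm (barenblatt_gradient p x t) \<le>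
      t powr (- (real DIM('a) + 1) / lam TYPE('a) p) * barenblatt_bound TYPE('a) p * ball_ind"
  proof (atomize (full), cases "norm x \<le> R * s")
    case True
    have 1: "m powr ((p - 1) / (p - 2)) \<le> C powr ((p - 1) / (p - 2)) + G"
      using powr_mono2[of "(p - 1) / (p - 2)" m C] m p G0 by simp
    have "norm x / s \<le> R"
      using True s by (simp add: field_simps)
    then have "(if x = 0 then 0 else (norm x / s) powr (1 / (p - 1))) \<le> R powr (1 / (p - 1))"
      using p s by (auto intro!: powr_mono2)
    then have "p / (p - 2) * k * m powr (1 / (p - 2)) * (if x = 0 then 0 else (norm x / s) powr (1 / (p - 1))) \<le> G"
      unfolding G_def using m p k by (intro mult_mono powr_mono2) auto
    then have 2: "p / (p - 2) * k * m powr (1 / (p - 2)) * (if x = 0 then 0 else (norm x / s) powr (1 / (p - 1)))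
        \<le> C powr ((p - 1) / (p - 2)) + G"
      by (simp add: add_increasing)
    have "ball_ind = 1"
      using True by (simp add: ball_ind_def R_def s_def)
    then show "\<bar>barenblatt p x t\<bar> \<le> t powr (- real DIM('a) / lam TYPE('a) p) * barenblatt_bound TYPE('a) p * ball_ind \<and>
      norm (barenblatt_gradient p x t) \<le>
        t powr (- (real DIM('a) + 1) / lam TYPE('a) p) * barenblatt_bound TYPE('a) p * ball_ind"
      using mult_left_mono[OF 1, of "t powr (- real DIM('a) / lam TYPE('a) p)"]
        mult_left_mono[OF 2, of "t powr (- (real DIM('a) + 1) / lam TYPE('a) p)"]
      unfolding Gr B M by simp
  next
    case False
    then have "m = 0"
      using barenblatt_cutoff[OF p s, of x] by (simp add: m_def C_def k_def R_def)
    then show "\<bar>barenblatt p x t\<bar> \<le> t powr (- real DIM('a) / lam TYPE('a) p) * barenblatt_bound TYPE('a) p * ball_ind \<and>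
      norm (barenblatt_gradient p x t) \<le>
        t powr (- (real DIM('a) + 1) / lam TYPE('a) p) * barenblatt_bound TYPE('a) p * ball_ind"
      using False unfolding Gr B by (simp add: ball_ind_def R_def s_def)
  qed
qed

section \<open>Continuity in the exponent and energy bounds\<close>

context
  fixes F :: "'i filter" and X :: "'i \<Rightarrow> real" and p :: real
  assumes X: "(X \<longlongrightarrow> p) F" and p: "p > 2"
begin

lemma lam_tendsto: "((\<lambda>i. lam TYPE('a::euclidean_space) (X i)) \<longlongrightarrow> lam TYPE('a) p) F"
  unfolding barenblatt_lambda_def by (intro tendsto_intros X)

lemma kap_tendsto: "((\<lambda>i. kap TYPE('a::euclidean_space) (X i)) \<longlongrightarrow> kap TYPE('a) p) F"
  unfolding kap_def using p lam_pos[OF p, where 'a = 'a] by (intro tendsto_intros X lam_tendsto) auto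

text \<open>On and outside the boundary of the support the base of the outer power tends to 0;
  \<open>tendsto_powr'\<close> still applies because (p-1)/(p-2) is positive.\<close>

lemma unit_profile_tendsto: "((\<lambda>i. unit_profile (X i) (x::'a::euclidean_space)) \<longlongrightarrow> unit_profile p x) F"
  unfolding unit_profile_def using p
  by (intro tendsto_powr' tendsto_max tendsto_diff tendsto_mult tendsto_divide tendsto_const X kap_tendsto) auto

lemma mass_exponent_tendsto:
  "((\<lambda>i. mass_exponent TYPE('a::euclidean_space) (X i)) \<longlongrightarrow> mass_exponent TYPE('a) p) F"
  unfolding mass_exponent_def using p by (intro tendsto_intros X) auto

end

text \<open>The support radii converge, so the profiles, which are at most 1, eventually live in one
  ball, of radius \<open>R p + 1\<close>; its indicator dominates.\<close>

lemma unit_mass_tendsto: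
  assumes X: "X \<longlonglongrightarrow> p" and p: "p > 2"
  shows "(\<lambda>i. unit_mass TYPE('a::euclidean_space) (X i)) \<longlonglongrightarrow> unit_mass TYPE('a) p"
proof -
  define R where "R = (\<lambda>p. (1 / kap TYPE('a) p) powr (1 / (p / (p - 1))))"
  have "(\<lambda>i. R (X i)) \<longlonglongrightarrow> R p"
    unfolding R_def using p kap_pos[OF p, where 'a = 'a]
    by (intro tendsto_intros X kap_tendsto p) auto
  then have "\<forall>\<^sub>F i in sequentially. R (X i) < R p + 1"
    by (rule order_tendstoD) simp
  with order_tendstoD(1)[OF X p] have "\<forall>\<^sub>F i in sequentially. X i > 2 \<and> R (X i) < R p + 1"
    by eventually_elim simp
  \<comment> \<open>Domination is required for every index, so an initial segment is dropped and the
    sequence shifted.\<close>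
  then obtain N where N: "\<And>i. i \<ge> N \<Longrightarrow> X i > 2 \<and> R (X i) < R p + 1"
    by (auto simp: eventually_sequentially)
  have "(\<lambda>i. unit_mass TYPE('a) (X (i + N))) \<longlonglongrightarrow> unit_mass TYPE('a) p"
    unfolding unit_mass_def
  proof (rule integral_dominated_convergence[where w = "indicator (cball 0 (R p + 1))"])
    show "integrable lborel (indicator (cball 0 (R p + 1)) :: 'a \<Rightarrow> real)"
      using emeasure_lborel_cball_finite[of "0::'a" "R p + 1"] by (intro integrable_real_indicator) auto
    show "AE x in lborel. (\<lambda>i. unit_profile (X (i + N)) (x::'a)) \<longlonglongrightarrow> unit_profile p x"
      by (intro AE_I2 unit_profile_tendsto p LIMSEQ_ignore_initial_segment X)
    show "AE x in lborel. norm (unit_profile (X (i + N)) (x::'a)) \<le> indicator (cball 0 (R p + 1)) x" for i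
    proof (rule AE_I2)
      fix x :: 'a
      have *: "X (i + N) > 2" "R (X (i + N)) < R p + 1" using N[of "i + N"] by auto
      show "norm (unit_profile (X (i + N)) x) \<le> indicator (cball 0 (R p + 1)) x"
        using unit_profile_bounds[OF *(1), of x] unit_profile_eq_0[OF *(1), of x] *(2)
        by (cases "norm x \<le> R p + 1") (auto simp: R_def)
    qed
  qed auto
  then show ?thesis by (rule LIMSEQ_offset)
qed

context
  fixes X :: "nat \<Rightarrow> real" and p :: real
  assumes X: "X \<longlonglongrightarrow> p" and p: "p > 2"
begin

lemma barenblatt_const_tendsto:
  "(\<lambda>i. barenblatt_const TYPE('a::euclidean_space) (X i)) \<longlonglongrightarrow> barenblatt_const TYPE('a) p"
proof -
  have "(\<lambda>i. (1 / unit_mass TYPE('a) (X i)) powr (1 / mass_exponent TYPE('a) (X i)))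
      \<longlonglongrightarrow> (1 / unit_mass TYPE('a) p) powr (1 / mass_exponent TYPE('a) p)"
    using unit_mass_pos[OF p, where 'a = 'a] mass_exponent_pos[OF p, where 'a = 'a]
    by (intro tendsto_intros unit_mass_tendsto mass_exponent_tendsto X p) auto
  moreover have "\<forall>\<^sub>F i in sequentially. (1 / unit_mass TYPE('a) (X i)) powr (1 / mass_exponent TYPE('a) (X i)) =
      barenblatt_const TYPE('a) (X i)"
    using order_tendstoD(1)[OF X p] by eventually_elim (simp add: barenblatt_const_eq)
  ultimately show ?thesis
    unfolding barenblatt_const_eq[OF p] by (rule Lim_transform_eventually)
qed

lemma barenblatt_tendsto:
  assumes "t > 0"
  shows "(\<lambda>i. barenblatt (X i) (x::'a::euclidean_space) t) \<longlonglongrightarrow> barenblatt p x t"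
  unfolding barenblatt_eq using p assms lam_pos[OF p, where 'a = 'a]
  by (intro tendsto_powr' tendsto_max tendsto_diff tendsto_mult tendsto_divide tendsto_minus tendsto_const
      X p kap_tendsto lam_tendsto barenblatt_const_tendsto) auto

text \<open>The point x is fixed, so the factor \<open>1 / norm x\<close> does not move with the
  exponent; at the origin all gradients are 0.\<close>

lemma barenblatt_gradient_tendsto:
  assumes "t > 0"
  shows "(\<lambda>i. barenblatt_gradient (X i) (x::'a::euclidean_space) t) \<longlonglongrightarrow> barenblatt_gradient p x t"
proof (cases "x = 0")
  case False
  then show ?thesis
    unfolding barenblatt_gradient_def using p assms lam_pos[OF p, where 'a = 'a]
    by (intro tendsto_scaleR tendsto_powr' tendsto_max tendsto_diff tendsto_mult tendsto_divide tendsto_minus tendsto_const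
        X p kap_tendsto lam_tendsto barenblatt_const_tendsto) auto
qed (simp add: barenblatt_gradient_def)

lemma barenblatt_radius_tendsto:
  "(\<lambda>i. barenblatt_radius TYPE('a::euclidean_space) (X i)) \<longlonglongrightarrow> barenblatt_radius TYPE('a) p"
  unfolding barenblatt_radius_def
  using p kap_pos[OF p, where 'a = 'a] barenblatt_const_pos[OF p, where 'a = 'a]
  by (intro tendsto_intros X p kap_tendsto barenblatt_const_tendsto) auto

lemma barenblatt_bound_tendsto:
  "(\<lambda>i. barenblatt_bound TYPE('a::euclidean_space) (X i)) \<longlonglongrightarrow> barenblatt_bound TYPE('a) p"
  unfolding barenblatt_bound_def
  using p kap_pos[OF p, where 'a = 'a] barenblatt_const_pos[OF p, where 'a = 'a]
  by (intro tendsto_powr' tendsto_intros X p kap_tendsto barenblatt_const_tendsto barenblatt_radius_tendsto)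
    (auto simp: barenblatt_radius_def)

end

lemma barenblatt_bound_nonneg: "p > 2 \<Longrightarrow> barenblatt_bound TYPE('a::euclidean_space) p \<ge> 0"
  using kap_pos[of p, where 'a = 'a] by (simp add: barenblatt_bound_def)

section \<open>Energy bounds and their integrability in time\<close>

lemma continuous_on_barenblatt:
  assumes p: "p > 2" and t: "t > 0"
  shows "continuous_on UNIV (\<lambda>x::'a::euclidean_space. barenblatt p x t)"
  by (rule has_derivative_continuous_on[where f' = "\<lambda>x v. barenblatt_gradient p x t \<bullet> v"])
    (simp add: barenblatt_has_derivative[OF p t])

text \<open>The q-th power of the pointwise bound times the volume of the support, both at t =
  1.\<close>

definition energy_const :: "'a::euclidean_space itself \<Rightarrow> real \<Rightarrow> real \<Rightarrow> real" where
  "energy_const d q p = barenblatt_bound TYPE('a) p powr q *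
     (unit_ball_vol (real DIM('a)) * barenblatt_radius TYPE('a) p ^ DIM('a))"

lemma energy_const_nonneg: "energy_const TYPE('a::euclidean_space) q p \<ge> 0"
  by (simp add: energy_const_def barenblatt_radius_def)

lemma set_integrable_energy:
  fixes f :: "'a::euclidean_space \<Rightarrow> real" and G :: "'a \<Rightarrow> 'a"
  assumes U: "open U" "bounded U" and q: "q > 0"
    and f: "continuous_on UNIV f" and G: "continuous_on UNIV G"
  shows "set_integrable lborel U (\<lambda>x. \<bar>f x\<bar> powr q + norm (G x) powr q)"
  using q by (intro set_integrable_bounded_continuous[OF _ U] continuous_on_add continuous_on_powr' continuous_intros f G) auto

text \<open>U is enlarged to the whole space and the support ball supplies the volume, a multiple of
  t^(n/\<lambda>). It turns the powers -nq/\<lambda> and -(n+1)q/\<lambda> of t into the two stated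
  ones.\<close>

lemma barenblatt_energy_bound:
  fixes U :: "'a::euclidean_space set"
  assumes p: "p > 2" and t: "t > 0" and q: "q \<ge> 1" and U: "open U" "bounded U"
  shows "(LINT x:U|lborel. \<bar>barenblatt p x t\<bar> powr q + norm (barenblatt_gradient p x t) powr q)
    \<le> energy_const TYPE('a) q p * (t powr (- (real DIM('a) * (q - 1) / lam TYPE('a) p)) +
        t powr (- (((real DIM('a) + 1) * q - real DIM('a)) / lam TYPE('a) p)))"
proof -
  let ?n = "real DIM('a)" and ?l = "lam TYPE('a) p"
  define R where "R = barenblatt_radius TYPE('a) p * t powr (1 / ?l)"
  define M where "M = barenblatt_bound TYPE('a) p"
  have M: "M \<ge> 0" using barenblatt_bound_nonneg[OF p] by (simp add: M_def)
  have R: "R \<ge> 0" by (simp add: R_def barenblatt_radius_def)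
  define A where "A = (t powr (- ?n / ?l * q) + t powr (- (?n + 1) / ?l * q)) * M powr q"
  have pw: "(c * M * indicator S x) powr q = c powr q * M powr q * indicator S x" if "c \<ge> 0" for c S and x :: 'a
    using that M q by (auto simp: indicator_def powr_mult)
  have le: "\<bar>barenblatt p x t\<bar> powr q + norm (barenblatt_gradient p x t) powr q \<le> A * indicator (cball 0 R) x" for x :: 'a
  proof -
    have "\<bar>barenblatt p x t\<bar> powr q \<le> (t powr (- ?n / ?l) * M * indicator (cball 0 R) x) powr q"
      using barenblatt_bounds(1)[OF p t, of x] q by (intro powr_mono2) (auto simp: M_def R_def)
    moreover have "norm (barenblatt_gradient p x t) powr q \<le> (t powr (- (?n + 1) / ?l) * M * indicator (cball 0 R) x) powr q"
      using barenblatt_bounds(2)[OF p t, of x] q by (intro powr_mono2) (auto simp: M_def R_def)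
    ultimately show ?thesis
      unfolding A_def pw[OF powr_ge_zero] by (simp add: powr_powr algebra_simps)
  qed
  have "(LINT x:U|lborel. \<bar>barenblatt p x t\<bar> powr q + norm (barenblatt_gradient p x t) powr q)
      \<le> (LINT x|lborel. A * indicator (cball 0 R) (x::'a))"
    unfolding set_lebesgue_integral_def
  proof (rule integral_mono)
    show "integrable lborel (\<lambda>x. indicator U x *\<^sub>R (\<bar>barenblatt p x t\<bar> powr q + norm (barenblatt_gradient p x t) powr q))"
      using set_integrable_energy[OF U _ continuous_on_barenblatt[OF p t] continuous_on_barenblatt_gradient[OF p t], of q] q
      by (simp add: set_integrable_def)
    show "integrable lborel (\<lambda>x::'a. A * indicator (cball 0 R) x)"
      using emeasure_lborel_cball_finite[of "0::'a" R] by (intro integrable_mult_right integrable_real_indicator) auto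
    have "A \<ge> 0" by (simp add: A_def)
    then show "indicator U x *\<^sub>R (\<bar>barenblatt p x t\<bar> powr q + norm (barenblatt_gradient p x t) powr q) \<le> A * indicator (cball 0 R) x" for x :: 'a
      using le[of x] by (cases "x \<in> U") auto
  qed
  also have "\<dots> = A * (unit_ball_vol ?n * R ^ DIM('a))"
    using content_cball[OF R, of "0::'a"] by simp
  also have "R ^ DIM('a) = barenblatt_radius TYPE('a) p ^ DIM('a) * t powr (?n / ?l)"
    using t by (simp add: R_def power_mult_distrib powr_realpow[symmetric] powr_powr)
  also have "A * (unit_ball_vol ?n * (barenblatt_radius TYPE('a) p ^ DIM('a) * t powr (?n / ?l))) =
      energy_const TYPE('a) q p * ((t powr (- ?n / ?l * q) + t powr (- (?n + 1) / ?l * q)) * t powr (?n / ?l))"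
    by (simp add: A_def energy_const_def M_def)
  also have "(t powr (- ?n / ?l * q) + t powr (- (?n + 1) / ?l * q)) * t powr (?n / ?l) =
      t powr (- (?n * (q - 1) / ?l)) + t powr (- (((?n + 1) * q - ?n) / ?l))"
    by (simp add: distrib_right powr_add[symmetric] add_divide_distrib diff_divide_distrib algebra_simps)
  finally show ?thesis .
qed

text \<open>Raises different exponents e to a common \<theta>. The factor t^(\<theta>-e) is bounded
  on (0,T), and taking the maximum with 1 makes powers of the base increase with the
  exponent.\<close>

lemma powr_neg_le:
  fixes t :: real
  assumes "0 < t" "t < T" "0 \<le> e" "e \<le> \<theta>"
  shows "t powr (- e) \<le> max 1 T powr \<theta> * t powr (- \<theta>)"
proof -
  have "t powr (\<theta> - e) \<le> max 1 T powr (\<theta> - e)"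
    using assms by (intro powr_mono2) auto
  also have "\<dots> \<le> max 1 T powr \<theta>"
    using assms by (intro powr_mono) auto
  finally have "t powr (\<theta> - e) * t powr (- \<theta>) \<le> max 1 T powr \<theta> * t powr (- \<theta>)"
    by (intro mult_right_mono) auto
  then show ?thesis by (simp add: powr_add[symmetric])
qed

lemma set_integrable_powr_neg:
  fixes \<theta> T c :: real
  assumes "\<theta> < 1" "T > 0"
  shows "set_integrable lborel {0<..<T} (\<lambda>t. c * t powr (- \<theta>))"
proof -
  have "(\<lambda>t. t powr (- \<theta>)) integrable_on {0..T}"
    using has_integral_powr_from_0[of "- \<theta>" T] assms by (auto simp: integrable_on_def)
  then have "set_integrable lebesgue {0..T} (\<lambda>t. t powr (- \<theta>))"
    \<comment> \<open>The gauge integral handles the singular endpoint; nonnegativity makes it an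
      absolutely convergent one.\<close>
    by (intro nonnegative_absolutely_integrable_1) auto
  then have "set_integrable lebesgue {0<..<T} (\<lambda>t. t powr (- \<theta>))"
    by (rule set_integrable_subset) auto
  then have "set_integrable lborel {0<..<T} (\<lambda>t. t powr (- \<theta>))"
    by (subst (asm) set_integral_lebesgue_eq_lborel(1)) measurable
  then show ?thesis by auto
qed

lemma powr_norm_diff_le:
  assumes q: "q > 0"
  shows "norm (a - b) powr q \<le> 2 powr q * (norm a powr q + norm b powr q)"
proof -
  have "norm (a - b) \<le> 2 * max (norm a) (norm b)"
    using norm_triangle_ineq4[of a b] by linarith
  then have "norm (a - b) powr q \<le> (2 * max (norm a) (norm b)) powr q"
    using q by (intro powr_mono2) auto
  also have "\<dots> = 2 powr q * max (norm a) (norm b) powr q"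
    by (simp add: powr_mult)
  also have "\<dots> \<le> 2 powr q * (norm a powr q + norm b powr q)"
    by (intro mult_left_mono) (auto simp: max_def)
  finally show ?thesis .
qed

section \<open>The energy of a difference at fixed time\<close>

definition difference_energy :: "'a::euclidean_space set \<Rightarrow> real \<Rightarrow> real \<Rightarrow> real \<Rightarrow> real \<Rightarrow> real" where
  "difference_energy U q p p' t = (LINT x:U|lborel. \<bar>barenblatt p' x t - barenblatt p x t\<bar> powr q +
     norm (barenblatt_gradient p' x t - barenblatt_gradient p x t) powr q)"

text \<open>At a fixed t > 0 nothing is singular: the pointwise bounds converge along the sequence,
  hence are bounded, and a constant on the bounded set U dominates.\<close>

lemma difference_energy_tendsto_0:
  fixes U :: "'a::euclidean_space set"
  assumes X: "X \<longlonglongrightarrow> p" and p: "p > 2" and X2: "\<And>i. X i > 2"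
    and t: "t > 0" and q: "q \<ge> 1" and U: "open U" "bounded U"
  shows "(\<lambda>i. difference_energy U q p (X i) t) \<longlonglongrightarrow> 0"
proof -
  have [measurable]: "U \<in> sets borel" using U by auto
  define b where "b = (\<lambda>p. t powr (- real DIM('a) / lam TYPE('a) p) * barenblatt_bound TYPE('a) p)"
  define g where "g = (\<lambda>p. t powr (- (real DIM('a) + 1) / lam TYPE('a) p) * barenblatt_bound TYPE('a) p)"
  have "(\<lambda>i. b (X i)) \<longlonglongrightarrow> b p" "(\<lambda>i. g (X i)) \<longlonglongrightarrow> g p"
    unfolding b_def g_def using t lam_pos[OF p, where 'a = 'a]
    by (intro tendsto_intros barenblatt_bound_tendsto lam_tendsto X p; simp)+
  then have "Bseq (\<lambda>i. b (X i))" "Bseq (\<lambda>i. g (X i))"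
    by (auto intro: convergent_imp_Bseq convergentI)
  then obtain K1 K2 where K1: "\<And>i. \<bar>b (X i)\<bar> \<le> K1" and K2: "\<And>i. \<bar>g (X i)\<bar> \<le> K2"
    by (auto simp: Bseq_def)
  have Bb: "\<bar>barenblatt p' x t\<bar> \<le> \<bar>b p'\<bar>" "norm (barenblatt_gradient p' x t) \<le> \<bar>g p'\<bar>"
    if "p' > 2" for p' and x :: 'a
    using barenblatt_bounds[OF that t, of x] barenblatt_bound_nonneg[OF that, where 'a = 'a]
    by (auto simp: b_def g_def indicator_def split: if_splits intro: order_trans)
  have "(\<lambda>i. LINT x|lborel. indicator U x *\<^sub>R (\<bar>barenblatt (X i) x t - barenblatt p x t\<bar> powr q +
      norm (barenblatt_gradient (X i) x t - barenblatt_gradient p x t) powr q)) \<longlonglongrightarrow> (LINT x::'a|lborel. 0)"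
  proof (rule integral_dominated_convergence[where w = "\<lambda>x. indicator U x * ((K1 + \<bar>b p\<bar>) powr q + (K2 + \<bar>g p\<bar>) powr q)"])
    show "integrable lborel (\<lambda>x. indicator U x * ((K1 + \<bar>b p\<bar>) powr q + (K2 + \<bar>g p\<bar>) powr q))"
      using emeasure_bounded_finite[OF U(2)] by (intro integrable_mult_left integrable_real_indicator) auto
    show "(\<lambda>x. indicator U x *\<^sub>R (\<bar>barenblatt (X i) x t - barenblatt p x t\<bar> powr q +
      norm (barenblatt_gradient (X i) x t - barenblatt_gradient p x t) powr q)) \<in> borel_measurable lborel" for i
      by measurable
    show "AE x in lborel. (\<lambda>i. indicator U x *\<^sub>R (\<bar>barenblatt (X i) x t - barenblatt p x t\<bar> powr q +
      norm (barenblatt_gradient (X i) x t - barenblatt_gradient p x t) powr q)) \<longlonglongrightarrow> 0"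
    proof (rule AE_I2)
      fix x :: 'a
      have "(\<lambda>i. indicator U x *\<^sub>R (\<bar>barenblatt (X i) x t - barenblatt p x t\<bar> powr q +
        norm (barenblatt_gradient (X i) x t - barenblatt_gradient p x t) powr q)) \<longlonglongrightarrow>
        indicator U x *\<^sub>R (\<bar>barenblatt p x t - barenblatt p x t\<bar> powr q +
        norm (barenblatt_gradient p x t - barenblatt_gradient p x t) powr q)"
        using q by (intro tendsto_powr' tendsto_intros barenblatt_tendsto barenblatt_gradient_tendsto X p t) auto
      then show "(\<lambda>i. indicator U x *\<^sub>R (\<bar>barenblatt (X i) x t - barenblatt p x t\<bar> powr q +
        norm (barenblatt_gradient (X i) x t - barenblatt_gradient p x t) powr q)) \<longlonglongrightarrow> 0"
        by simp
    qed
    show "AE x in lborel. norm (indicator U x *\<^sub>R (\<bar>barenblatt (X i) x t - barenblatt p x t\<bar> powr q +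
        norm (barenblatt_gradient (X i) x t - barenblatt_gradient p x t) powr q))
        \<le> indicator U x * ((K1 + \<bar>b p\<bar>) powr q + (K2 + \<bar>g p\<bar>) powr q)" for i
    proof (rule AE_I2)
      fix x :: 'a
      have "\<bar>barenblatt (X i) x t - barenblatt p x t\<bar> \<le> K1 + \<bar>b p\<bar>"
        using Bb(1)[OF X2, of i x] Bb(1)[OF p, of x] K1[of i] by linarith
      moreover have "norm (barenblatt_gradient (X i) x t - barenblatt_gradient p x t) \<le> K2 + \<bar>g p\<bar>"
        using Bb(2)[OF X2, of i x] Bb(2)[OF p, of x] K2[of i]
          norm_triangle_ineq4[of "barenblatt_gradient (X i) x t" "barenblatt_gradient p x t"] by linarith
      ultimately show "norm (indicator U x *\<^sub>R (\<bar>barenblatt (X i) x t - barenblatt p x t\<bar> powr q +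
        norm (barenblatt_gradient (X i) x t - barenblatt_gradient p x t) powr q))
        \<le> indicator U x * ((K1 + \<bar>b p\<bar>) powr q + (K2 + \<bar>g p\<bar>) powr q)"
        using q by (auto simp: indicator_def intro!: add_mono powr_mono2)
    qed
  qed auto
  then show ?thesis
    by (simp add: difference_energy_def set_lebesgue_integral_def)
qed

lemma barenblatt_difference:
  fixes p p' :: real
  assumes p: "p > 2" "p' > 2"
  shows "(\<lambda>(x::'a::euclidean_space, t). barenblatt p' x t - barenblatt p x t) \<in> borel_measurable (borel \<Otimes>\<^sub>M borel)"
    and "(\<lambda>(x::'a::euclidean_space, t). barenblatt_gradient p' x t - barenblatt_gradient p x t) \<in> borel_measurable (borel \<Otimes>\<^sub>M borel)"
    and "t > 0 \<Longrightarrow> ((\<lambda>x::'a. barenblatt p' x t - barenblatt p x t) has_derivative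
      (\<lambda>v. (barenblatt_gradient p' x t - barenblatt_gradient p x t) \<bullet> v)) (at x)"
    and "t > 0 \<Longrightarrow> continuous_on UNIV (\<lambda>x::'a. barenblatt_gradient p' x t - barenblatt_gradient p x t)"
proof -
  show "t > 0 \<Longrightarrow> ((\<lambda>x::'a. barenblatt p' x t - barenblatt p x t) has_derivative
      (\<lambda>v. (barenblatt_gradient p' x t - barenblatt_gradient p x t) \<bullet> v)) (at x)"
    unfolding inner_diff_left by (intro has_derivative_diff barenblatt_has_derivative p)
  show "t > 0 \<Longrightarrow> continuous_on UNIV (\<lambda>x::'a. barenblatt_gradient p' x t - barenblatt_gradient p x t)"
    by (intro continuous_intros continuous_on_barenblatt_gradient p)
qed measurable

text \<open>Transfers the time bounds of the two single solutions to their difference, which is how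
  the dominating function in t arises.\<close>

lemma difference_energy_le:
  fixes U :: "'a::euclidean_space set"
  assumes p: "p > 2" "p' > 2" and t: "t > 0" and q: "q \<ge> 1" and U: "open U" "bounded U"
  shows "difference_energy U q p p' t \<le> 2 powr q *
    ((LINT x:U|lborel. \<bar>barenblatt p' x t\<bar> powr q + norm (barenblatt_gradient p' x t) powr q) +
     (LINT x:U|lborel. \<bar>barenblatt p x t\<bar> powr q + norm (barenblatt_gradient p x t) powr q))"
proof -
  have q0: "q > 0" using q by simp
  let ?f = "\<lambda>p x. \<bar>barenblatt p (x::'a) t\<bar> powr q + norm (barenblatt_gradient p x t) powr q"
  have int: "set_integrable lborel U (?f p)" if "p > 2" for p
    by (rule set_integrable_energy[OF U q0 continuous_on_barenblatt[OF that t] continuous_on_barenblatt_gradient[OF that t]])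
  have "difference_energy U q p p' t \<le> (LINT x:U|lborel. 2 powr q * (?f p' x + ?f p x))"
    unfolding difference_energy_def
  proof (rule set_integral_mono)
    show "set_integrable lborel U (\<lambda>x. \<bar>barenblatt p' x t - barenblatt p x t\<bar> powr q +
        norm (barenblatt_gradient p' x t - barenblatt_gradient p x t) powr q)"
      by (intro set_integrable_energy U q0 continuous_intros continuous_on_barenblatt continuous_on_barenblatt_gradient p t)
    show "set_integrable lborel U (\<lambda>x. 2 powr q * (?f p' x + ?f p x))"
      by (intro set_integrable_mult_right set_integral_add(1)[OF int[OF p(2)] int[OF p(1)]])
    show "\<bar>barenblatt p' x t - barenblatt p x t\<bar> powr q + norm (barenblatt_gradient p' x t - barenblatt_gradient p x t) powr q
        \<le> 2 powr q * (?f p' x + ?f p x)" for x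
      using powr_norm_diff_le[OF q0, of "barenblatt p' x t" "barenblatt p x t"]
        powr_norm_diff_le[OF q0, of "barenblatt_gradient p' x t" "barenblatt_gradient p x t"]
      by (simp add: distrib_left)
  qed
  also have "\<dots> = 2 powr q * ((LINT x:U|lborel. ?f p' x) + (LINT x:U|lborel. ?f p x))"
    using set_integral_add(2)[OF int[OF p(2)] int[OF p(1)]] by simp
  finally show ?thesis .
qed

text \<open>The two exponents differ by q/\<lambda>, the cost of one space derivative, so the
  gradient term governs the singularity.\<close>

lemma energy_exponents:
  assumes p: "p > 2" and q: "q \<ge> 1"
  shows "0 \<le> real DIM('a::euclidean_space) * (q - 1) / lam TYPE('a) p"
    and "real DIM('a) * (q - 1) / lam TYPE('a) p \<le> ((real DIM('a) + 1) * q - real DIM('a)) / lam TYPE('a) p"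
  using q lam_pos[OF p, where 'a = 'a] by (auto intro!: divide_right_mono simp: algebra_simps)

text \<open>\<theta> and K are left free: with equality the estimate serves a single p, with slack
  it holds uniformly along a sequence of exponents. The factor 2 counts the two powers of t.\<close>

lemma barenblatt_energy_le_powr:
  fixes U :: "'a::euclidean_space set"
  assumes p: "p > 2" and t: "0 < t" "t < T" and q: "q \<ge> 1" and U: "open U" "bounded U"
    and \<theta>: "((real DIM('a) + 1) * q - real DIM('a)) / lam TYPE('a) p \<le> \<theta>"
    and K: "energy_const TYPE('a) q p \<le> K"
  shows "(LINT x:U|lborel. \<bar>barenblatt p x t\<bar> powr q + norm (barenblatt_gradient p x t) powr q)
    \<le> K * (2 * max 1 T powr \<theta>) * t powr (- \<theta>)"
proof -
  let ?e1 = "real DIM('a) * (q - 1) / lam TYPE('a) p"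
  let ?e2 = "((real DIM('a) + 1) * q - real DIM('a)) / lam TYPE('a) p"
  have e: "0 \<le> ?e1" "?e1 \<le> \<theta>" "0 \<le> ?e2"
    using energy_exponents[OF p q, where 'a = 'a] \<theta> by linarith+
  have "t powr (- ?e1) + t powr (- ?e2) \<le> 2 * max 1 T powr \<theta> * t powr (- \<theta>)"
    using powr_neg_le[OF t e(1,2)] powr_neg_le[OF t e(3) \<theta>] by linarith
  then have "energy_const TYPE('a) q p * (t powr (- ?e1) + t powr (- ?e2)) \<le> K * (2 * max 1 T powr \<theta> * t powr (- \<theta>))"
    using K energy_const_nonneg[of q p, where 'a = 'a] by (intro mult_mono) auto
  then show ?thesis
    using barenblatt_energy_bound[OF p t(1) q U] by (simp add: mult.assoc)
qed

text \<open>The identity \<lambda> = (n+1)(p-1) + 1 - n turns (n+1)q - n < \<lambda> into the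
  assumed bound on q.\<close>

lemma energy_exponent_less_1:
  assumes p: "p > 2" and q: "q < p - 1 + 1 / (real DIM('a::euclidean_space) + 1)"
  shows "((real DIM('a) + 1) * q - real DIM('a)) / lam TYPE('a) p < 1"
proof -
  have "(real DIM('a) + 1) * q < (real DIM('a) + 1) * (p - 1 + 1 / (real DIM('a) + 1))"
    using q by (intro mult_strict_left_mono) auto
  then have "(real DIM('a) + 1) * q - real DIM('a) < lam TYPE('a) p"
    by (simp add: barenblatt_lambda_def algebra_simps)
  then show ?thesis
    using lam_pos[OF p, where 'a = 'a] by simp
qed

section \<open>Membership and convergence in the parabolic Sobolev space\<close>

lemma barenblatt_in_parabolic_sobolev_space:
  fixes U :: "'a::euclidean_space set"
  assumes p: "p > 2" and T: "T > 0" and U: "open U" "bounded U"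
    and q: "1 \<le> q" "q < p - 1 + 1 / (real DIM('a) + 1)"
  shows "barenblatt p \<in> parabolic_sobolev_space q T U"
  by (rule parabolic_sobolev_C1(2)[OF U _ barenblatt_measurable barenblatt_gradient_measurable
      barenblatt_has_derivative[OF p] continuous_on_barenblatt_gradient[OF p]
      set_integrable_powr_neg[OF energy_exponent_less_1[OF p q(2)] T]
      barenblatt_energy_le_powr[OF p _ _ q(1) U order_refl order_refl]])
    (use q in auto)

lemma barenblatt_norm_tendsto_0:
  fixes U :: "'a::euclidean_space set"
  assumes p: "p > 2" and T: "T > 0" and U: "open U" "bounded U"
    and q: "1 \<le> q" "q < p - 1 + 1 / (real DIM('a) + 1)"
    and X: "X \<longlonglongrightarrow> p"
  shows "(\<lambda>i. parabolic_sobolev_norm q T U (\<lambda>x t. barenblatt (X i) x t - barenblatt p x t)) \<longlonglongrightarrow> 0"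
proof -
  define e where "e = (\<lambda>p. ((real DIM('a) + 1) * q - real DIM('a)) / lam TYPE('a) p)"
  have "e p < 1"
    unfolding e_def by (rule energy_exponent_less_1[OF p q(2)])
  \<comment> \<open>The gap above \<open>e p\<close> absorbs the variation of the exponents
    \<open>e (X i)\<close>, while \<theta> < 1 keeps t^(-\<theta>) integrable at 0.\<close>
  then obtain \<theta> where \<theta>: "e p < \<theta>" "\<theta> < 1"
    using dense by blast
  \<comment> \<open>Likewise the added 1 leaves room for the energy constants of the
    sequence.\<close>
  define K where "K = energy_const TYPE('a) q p + 1"
  have "(\<lambda>i. e (X i)) \<longlonglongrightarrow> e p"
    unfolding e_def using lam_pos[OF p, where 'a = 'a] by (intro tendsto_intros lam_tendsto X p) auto
  then have ev1: "\<forall>\<^sub>F i in sequentially. e (X i) < \<theta>"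
    using \<theta>(1) by (rule order_tendstoD)
  have "(\<lambda>i. energy_const TYPE('a) q (X i)) \<longlonglongrightarrow> energy_const TYPE('a) q p"
    unfolding energy_const_def using q barenblatt_bound_nonneg[where 'a = 'a]
    by (intro tendsto_powr' tendsto_intros barenblatt_bound_tendsto barenblatt_radius_tendsto X p)
      (auto intro!: eventually_mono[OF order_tendstoD(1)[OF X p]])
  then have ev2: "\<forall>\<^sub>F i in sequentially. energy_const TYPE('a) q (X i) < K"
    by (rule order_tendstoD) (simp add: K_def)
  from ev1 ev2 order_tendstoD(1)[OF X p]
  have "\<forall>\<^sub>F i in sequentially. X i > 2 \<and> e (X i) < \<theta> \<and> energy_const TYPE('a) q (X i) < K"
    by eventually_elim simp
  then obtain N where N: "\<And>i. i \<ge> N \<Longrightarrow> X i > 2 \<and> e (X i) < \<theta> \<and> energy_const TYPE('a) q (X i) < K"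
    by (auto simp: eventually_sequentially)
  define Y where "Y = (\<lambda>i. X (i + N))"
  have Y: "Y \<longlonglongrightarrow> p"
    unfolding Y_def by (rule LIMSEQ_ignore_initial_segment[OF X])
  have Y2: "Y i > 2" and Ye: "e (Y i) \<le> \<theta>" and YK: "energy_const TYPE('a) q (Y i) \<le> K" for i
    using N[of "i + N"] by (auto simp: Y_def)
  have q0: "q > 0" using q by simp
  \<comment> \<open>One summand for \<open>Y i\<close> and one for p, with 2^q from splitting the
    difference; independent of i.\<close>
  define h where "h = (\<lambda>t. 2 powr q * (K * (2 * max 1 T powr \<theta>) + K * (2 * max 1 T powr \<theta>)) * t powr (- \<theta>))"
  have h: "set_integrable lborel {0<..<T} h"
    unfolding h_def by (rule set_integrable_powr_neg[OF \<theta>(2) T])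
  have bound: "difference_energy U q p (Y i) t \<le> h t" if t: "0 < t" "t < T" for i t
  proof -
    have "2 powr q * ((LINT x:U|lborel. \<bar>barenblatt (Y i) x t\<bar> powr q + norm (barenblatt_gradient (Y i) x t) powr q) +
        (LINT x:U|lborel. \<bar>barenblatt p x t\<bar> powr q + norm (barenblatt_gradient p x t) powr q))
      \<le> 2 powr q * (K * (2 * max 1 T powr \<theta>) * t powr (- \<theta>) + K * (2 * max 1 T powr \<theta>) * t powr (- \<theta>))"
      using \<theta>(1) Ye YK
      by (intro mult_left_mono add_mono barenblatt_energy_le_powr Y2 p t q U) (auto simp: e_def K_def)
    then show ?thesis
      using difference_energy_le[OF p Y2 t(1) q(1) U, of i] by (simp add: h_def algebra_simps)
  qed
  note C1 = parabolic_sobolev_C1[OF U q0 barenblatt_difference[OF p Y2] h bound[unfolded difference_energy_def]]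
  have nn: "0 \<le> difference_energy U q p p' t" for p' t
    by (simp add: difference_energy_def set_lebesgue_integral_def)
  have meas [measurable]: "difference_energy U q p (Y i) \<in> borel_measurable borel" for i
    using C1(1)[of i] by (simp add: difference_energy_def[abs_def])
  have "(\<lambda>i. LINT t|lborel. indicator {0<..<T} t *\<^sub>R difference_energy U q p (Y i) t) \<longlonglongrightarrow> (LINT t::real|lborel. 0)"
  proof (rule integral_dominated_convergence[where w = "\<lambda>t. indicator {0<..<T} t *\<^sub>R h t"])
    show "integrable lborel (\<lambda>t. indicator {0<..<T} t *\<^sub>R h t)"
      using h by (simp add: set_integrable_def)
    show "AE t in lborel. (\<lambda>i. indicator {0<..<T} t *\<^sub>R difference_energy U q p (Y i) t) \<longlonglongrightarrow> 0"
    proof (rule AE_I2)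
      fix t :: real
      show "(\<lambda>i. indicator {0<..<T} t *\<^sub>R difference_energy U q p (Y i) t) \<longlonglongrightarrow> 0"
        using difference_energy_tendsto_0[OF Y p Y2 _ q(1) U, of t]
        by (cases "t \<in> {0<..<T}") auto
    qed
    show "AE t in lborel. norm (indicator {0<..<T} t *\<^sub>R difference_energy U q p (Y i) t) \<le> indicator {0<..<T} t *\<^sub>R h t" for i
      using bound nn by (intro AE_I2) (auto simp: indicator_def)
  qed auto
  then have lim: "(\<lambda>i. LINT t:{0<..<T}|lborel. difference_energy U q p (Y i) t) \<longlonglongrightarrow> 0"
    by (simp add: set_lebesgue_integral_def)
  have "(\<lambda>i. (LINT t:{0<..<T}|lborel. difference_energy U q p (Y i) t) powr (1 / q)) \<longlonglongrightarrow> 0 powr (1 / q)"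
    using q0 nn by (intro tendsto_powr' lim tendsto_const) (auto simp: set_lebesgue_integral_def)
  then have "(\<lambda>i. parabolic_sobolev_norm q T U (\<lambda>x t. barenblatt (Y i) x t - barenblatt p x t)) \<longlonglongrightarrow> 0"
    using C1(3) by (simp add: difference_energy_def)
  then show ?thesis
    unfolding Y_def by (rule LIMSEQ_offset)
qed

theorem mainTheorem2:
  fixes p q T :: real and U :: "'a::euclidean_space set"
  assumes "p > 2" and "T > 0"
    and "open U" and "bounded U"
    and "1 \<le> q" and "q < p - 1 + 1 / (real DIM('a) + 1)"
  shows "parabolic_sobolev_tendsto q T U (\<lambda>p'. barenblatt p') (barenblatt p) (at p)"
  unfolding parabolic_sobolev_tendsto_def
proof (intro conjI)
  show "barenblatt p \<in> parabolic_sobolev_space q T U"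
    by (rule barenblatt_in_parabolic_sobolev_space[OF assms])
  have "\<forall>\<^sub>F p' in at p. p' > 2"
    by (rule order_tendstoD(1)[OF tendsto_ident_at assms(1)])
  \<comment> \<open>The bound on q read as a lower bound on p': an open condition, so it persists
    near p.\<close>
  moreover have "\<forall>\<^sub>F p' in at p. p' > q + 1 - 1 / (real DIM('a) + 1)"
    by (rule order_tendstoD(1)[OF tendsto_ident_at]) (use assms(6) in linarith)
  ultimately show "\<forall>\<^sub>F p' in at p. barenblatt p' \<in> parabolic_sobolev_space q T U"
    by eventually_elim (rule barenblatt_in_parabolic_sobolev_space, use assms in auto)
  show "((\<lambda>p'. parabolic_sobolev_norm q T U (\<lambda>x t. barenblatt p' x t - barenblatt p x t)) \<longlongrightarrow> 0) (at p)"
    \<comment> \<open>Reduces the limit at p to sequences, for which dominated convergence was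
      used.\<close>
    unfolding tendsto_at_iff_sequentially comp_def
    using barenblatt_norm_tendsto_0[OF assms] by blast
qed

end
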